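(* Let $0\leq\alpha<1$, let $\sigma$ and $\omega$ be locally finite positive Borel measures on $\mathbb{R}$, and let $\kappa\in\mathbb{N}$, $\kappa\geq 1$. If $T^{\alpha}$ is an $\alpha$-fractional Calderón–Zygmund operator on $\mathbb{R}$ that is bounded from $L^{2}(\sigma)$ to $L^{2}(\omega)$, then $$\mathfrak{T}_{T^{\alpha}}^{(\kappa)}(\sigma,\omega)\leq \kappa!\,\mathfrak{T}_{T^{\alpha}}(\sigma,\omega)+C_{\kappa}\sqrt{\mathcal{A}_{2}^{\alpha}(\sigma,\omega)},$$ where the constant $C_{\kappa}$ depends on the kernel constant $C_{CZ}$ of $T^\alpha$, but is independent of the operator norm $\mathfrak{N}_{T^{\alpha}}(\sigma,\omega)$.
   Context: Here the dimension is $n=1$; definitions are given for general $n$. $\mathcal{P}^{n}$ is the collection of all cubes in $\mathbb{R}^{n}$ with sides parallel to the coordinate axes (intervals if $n=1$); $\ell(Q)$ is the side length of $Q$, $c_{Q}=x_Q$ its center, $|Q|$ its Lebesgue measure and $|Q|_{\mu}=\mu(Q)$. Kernel: for $0\le\alpha<n$, $\kappa_1,\kappa_2\in\mathbb{N}$, $\delta>0$, $K^{\alpha}(x,y)$, defined for $x\ne y$, is a standard $(\kappa_1+\delta,\kappa_2+\delta)$-smooth $\alpha$-fractional (Calderón–Zygmund) kernel if $$|\nabla_{1}^{j}K^{\alpha}(x,y)|\leq C_{CZ}|x-y|^{\alpha-j-n}\quad(0\leq j\leq\kappa_1),$$ $$|\nabla_{1}^{\kappa_1}K^{\alpha}(x,y)-\nabla_{1}^{\kappa_1}K^{\alpha}(x',y)|\leq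 C_{CZ}\Big(\frac{|x-x'|}{|x-y|}\Big)^{\delta}|x-y|^{\alpha-\kappa_1-n}\quad\text{if }\frac{|x-x'|}{|x-y|}\leq\frac12,$$ and the same inequalities hold for the adjoint kernel $K^{\alpha,*}(x,y)=K^{\alpha}(y,x)$ with $\kappa_2$ in place of $\kappa_1$ ($\nabla_1$ is the gradient in the first variable). Operator: an $\alpha$-fractional singular integral (Calderón–Zygmund) operator $T^{\alpha}$ is such a kernel (for some $\kappa_1,\kappa_2,\delta$) together with a family of truncation functions $\eta_{\delta,R}^{\alpha}$, $0<\delta<R<\infty$, on $[0,\infty)$ (nonnegative, smooth, equal to $1$ on $[\delta,R]$, vanishing near $0$ and near $\infty$) such that the truncated kernels $K_{\delta,R}^{\alpha}(x,y)=\eta_{\delta,R}^{\alpha}(|x-y|)K^{\alpha}(x,y)$ satisfy the size and smoothness inequalities defining a standard smooth $\alpha$-fractional kernel (with the same $\kappa_1,\kappa_2$ and the same Hölder exponent as $K^\alpha$, the latter not to be confused with the truncation parameter $\delta$) with a constant $C_{CZ}$ uniform in the truncation parameters $\delta,R$. $T^{\alpha}_{\sigma}f=T^{\alpha}(f\sigma)$ means, for a given truncation, $\int K^{\alpha}_{\delta,R}(x,y)f(y)\,d\sigma(y)$. All norms and testing constants are understood as holding uniformly over all truncations. $T^\alpha$ is bounded from $L^2(\sigma)$ to $L^2(\omega)$ with norm $\mathfrak{N}_{T^\alpha}(\sigma,\omega)$ if $\|T^{\alpha}_{\sigma}f\|_{L^2(\omega)}\le \mathfrak{N}_{T^\alpha}(\sigma,\omega)\|f\|_{L^2(\sigma)}$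 uniformly over truncations (smallest such constant). Testing: for a multiindex $\beta$ let $m_{Q}^{\beta}(x)=\big(\frac{x-c_Q}{\ell(Q)}\big)^{\beta}$, and $$\big(\mathfrak{T}_{T^{\alpha}}^{(\kappa)}(\sigma,\omega)\big)^{2}=\sup_{Q\in\mathcal{P}^{n}}\max_{0\leq|\beta|<\kappa}\frac{1}{|Q|_{\sigma}}\int_{Q}|T_{\sigma}^{\alpha}(\mathbf{1}_{Q}m_{Q}^{\beta})|^{2}\,d\omega ,$$ the supremum being over cubes with $|Q|_\sigma>0$. $\mathfrak{T}_{T^{\alpha}}=\mathfrak{T}_{T^{\alpha}}^{(1)}$ (testing on indicators $\mathbf 1_Q$ only). One-tailed Muckenhoupt constant: $$\mathcal{A}_{2}^{\alpha}(\sigma,\omega)=\sup_{Q\in\mathcal{P}^{n}}\mathcal{P}^{\alpha}(Q,\sigma)\frac{|Q|_{\omega}}{|Q|^{1-\frac{\alpha}{n}}},\qquad \mathcal{P}^{\alpha}(Q,\mu)=\int_{\mathbb{R}^{n}}\Big(\frac{|Q|^{1/n}}{(|Q|^{1/n}+|x-x_{Q}|)^{2}}\Big)^{n-\alpha}d\mu(x).$$ *)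

theory Defs
  imports "HOL-Analysis.Analysis"
begin

text \<open>
  Scalars are taken from a type of sort
  \<open>{real_normed_field, banach, second_countable_topology}\<close>, so that real and complex
  kernels are both covered.
\<close>

subsection \<open>Extended nonnegative square root, measures, cubes\<close>

definition enn_sqrt :: "ennreal \<Rightarrow> ennreal" where
  "enn_sqrt x = (if x = \<infinity> then \<infinity> else ennreal (sqrt (enn2real x)))"

definition locally_finite_borel :: "real measure \<Rightarrow> bool" where
  "locally_finite_borel \<mu> \<longleftrightarrow>
     sets \<mu> = sets borel \<and> (\<forall>x. \<exists>U. open U \<and> x \<in> U \<and> emeasure \<mu> U < \<infinity>)"

text \<open>Cubes in dimension one: bounded nondegenerate intervals, with or without their endpoints.\<close>

definition cubes :: "real set set" where
  "cubes = {Q. is_interval Q \<and> bounded Q \<and> interior Q \<noteq> {}}"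

definition side :: "real set \<Rightarrow> real" where
  "side Q = measure lborel Q"

definition center :: "real set \<Rightarrow> real" where
  "center Q = (Inf Q + Sup Q) / 2"

definition monomial :: "real set \<Rightarrow> nat \<Rightarrow> real \<Rightarrow> real" where
  "monomial Q j x = ((x - center Q) / side Q) ^ j"

definition L2_norm :: "real measure \<Rightarrow> (real \<Rightarrow> 'a::real_normed_vector) \<Rightarrow> ennreal" where
  "L2_norm \<mu> f = enn_sqrt (\<integral>\<^sup>+ x. (ennreal (norm (f x)))\<^sup>2 \<partial>\<mu>)"

subsection \<open>Smooth fractional kernels\<close>

definition iter_deriv :: "nat \<Rightarrow> (real \<Rightarrow> 'a::real_normed_vector) \<Rightarrow> real \<Rightarrow> 'a" where
  "iter_deriv j f = ((\<lambda>g x. vector_derivative g (at x)) ^^ j) f"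

text \<open>
  The conditions on the derivatives in the first variable, up to order \<open>k\<close>. The values of \<open>K\<close>
  on the diagonal are irrelevant: every derivative below is taken at a point off the diagonal.
\<close>

definition kernel_bounds ::
  "real \<Rightarrow> nat \<Rightarrow> real \<Rightarrow> real \<Rightarrow> (real \<Rightarrow> real \<Rightarrow> 'a::real_normed_vector) \<Rightarrow> bool" where
  "kernel_bounds \<alpha> k \<delta> C K \<longleftrightarrow>
     (\<forall>x y. x \<noteq> y \<longrightarrow> (\<forall>j<k. iter_deriv j (\<lambda>t. K t y) differentiable (at x))) \<and>
     (\<forall>x y. x \<noteq> y \<longrightarrow> (\<forall>j\<le>k.
        norm (iter_deriv j (\<lambda>t. K t y) x) \<le> C * \<bar>x - y\<bar> powr (\<alpha> - real j - 1))) \<and>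
     (\<forall>x x' y. x \<noteq> y \<longrightarrow> \<bar>x - x'\<bar> / \<bar>x - y\<bar> \<le> 1 / 2 \<longrightarrow>
        norm (iter_deriv k (\<lambda>t. K t y) x - iter_deriv k (\<lambda>t. K t y) x')
          \<le> C * (\<bar>x - x'\<bar> / \<bar>x - y\<bar>) powr \<delta> * \<bar>x - y\<bar> powr (\<alpha> - real k - 1))"

definition standard_kernel ::
  "real \<Rightarrow> nat \<Rightarrow> nat \<Rightarrow> real \<Rightarrow> real \<Rightarrow> (real \<Rightarrow> real \<Rightarrow> 'a::real_normed_vector) \<Rightarrow> bool" where
  "standard_kernel \<alpha> k1 k2 \<delta> C K \<longleftrightarrow>
     kernel_bounds \<alpha> k1 \<delta> C K \<and> kernel_bounds \<alpha> k2 \<delta> C (\<lambda>x y. K y x)"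

subsection \<open>Truncations and singular integral operators\<close>

text \<open>
  Smoothness is only required on the open half line; at \<open>0\<close> it is automatic, as the function
  vanishes near \<open>0\<close>.
\<close>

definition truncation_function :: "real \<Rightarrow> real \<Rightarrow> (real \<Rightarrow> real) \<Rightarrow> bool" where
  "truncation_function \<epsilon> R \<phi> \<longleftrightarrow>
     (\<forall>t\<ge>0. \<phi> t \<ge> 0) \<and>
     (\<forall>j. \<forall>t>0. iter_deriv j \<phi> differentiable (at t)) \<and>
     (\<forall>t\<in>{\<epsilon>..R}. \<phi> t = 1) \<and>
     (\<exists>a>0. \<forall>t\<in>{0..<a}. \<phi> t = 0) \<and>
     (\<exists>b. \<forall>t\<ge>b. \<phi> t = 0)"

definition truncated_kernel ::
  "(real \<Rightarrow> real \<Rightarrow> real \<Rightarrow> real) \<Rightarrow> (real \<Rightarrow> real \<Rightarrow> 'a::real_normed_field)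
     \<Rightarrow> real \<Rightarrow> real \<Rightarrow> real \<Rightarrow> real \<Rightarrow> 'a" where
  "truncated_kernel \<eta> K \<epsilon> R x y = of_real (\<eta> \<epsilon> R \<bar>x - y\<bar>) * K x y"

definition truncations :: "(real \<times> real) set" where
  "truncations = {(\<epsilon>, R). 0 < \<epsilon> \<and> \<epsilon> < R}"

text \<open>
  An operator is a pair of a kernel \<open>K\<close> and a family \<open>\<eta>\<close> of truncation functions; \<open>C\<close> is the
  kernel constant, valid for the kernel and for all its truncations.
\<close>

definition fractional_CZ_operator ::
  "real \<Rightarrow> real \<Rightarrow> (real \<Rightarrow> real \<Rightarrow> 'a::real_normed_field)
     \<Rightarrow> (real \<Rightarrow> real \<Rightarrow> real \<Rightarrow> real) \<Rightarrow> bool" where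
  "fractional_CZ_operator \<alpha> C K \<eta> \<longleftrightarrow>
     (\<exists>k1 k2 \<delta>. \<delta> > 0 \<and> standard_kernel \<alpha> k1 k2 \<delta> C K \<and>
        (\<forall>(\<epsilon>, R)\<in>truncations.
           truncation_function \<epsilon> R (\<eta> \<epsilon> R) \<and>
           standard_kernel \<alpha> k1 k2 \<delta> C (truncated_kernel \<eta> K \<epsilon> R)))"

definition T_op ::
  "(real \<Rightarrow> real \<Rightarrow> 'a::{real_normed_field,banach,second_countable_topology})
     \<Rightarrow> (real \<Rightarrow> real \<Rightarrow> real \<Rightarrow> real) \<Rightarrow> real \<Rightarrow> real \<Rightarrow> real measure \<Rightarrow> (real \<Rightarrow> 'a) \<Rightarrow> real \<Rightarrow> 'a" where
  "T_op K \<eta> \<epsilon> R \<sigma> f x = (LINT y|\<sigma>. truncated_kernel \<eta> K \<epsilon> R x y * f y)"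

definition bounded_L2_op ::
  "(real \<Rightarrow> real \<Rightarrow> 'a::{real_normed_field,banach,second_countable_topology})
     \<Rightarrow> (real \<Rightarrow> real \<Rightarrow> real \<Rightarrow> real) \<Rightarrow> real measure \<Rightarrow> real measure \<Rightarrow> bool" where
  "bounded_L2_op K \<eta> \<sigma> \<omega> \<longleftrightarrow>
     (\<exists>N\<ge>0. \<forall>(\<epsilon>, R)\<in>truncations. \<forall>f\<in>borel_measurable \<sigma>. L2_norm \<sigma> f < \<infinity> \<longrightarrow>
        L2_norm \<omega> (T_op K \<eta> \<epsilon> R \<sigma> f) \<le> ennreal N * L2_norm \<sigma> f)"

subsection \<open>Testing and Muckenhoupt constants\<close>

text \<open>The inner supremum is a maximum over finitely many exponents.\<close>

definition testing_const ::
  "nat \<Rightarrow> (real \<Rightarrow> real \<Rightarrow> 'a::{real_normed_field,banach,second_countable_topology})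
     \<Rightarrow> (real \<Rightarrow> real \<Rightarrow> real \<Rightarrow> real) \<Rightarrow> real measure \<Rightarrow> real measure \<Rightarrow> ennreal" where
  "testing_const \<kappa> K \<eta> \<sigma> \<omega> = enn_sqrt (
     SUP (\<epsilon>, R)\<in>truncations. SUP Q\<in>{Q \<in> cubes. emeasure \<sigma> Q > 0}. SUP j\<in>{..<\<kappa>}.
       1 / emeasure \<sigma> Q *
       (\<integral>\<^sup>+ x\<in>Q. (ennreal (norm (T_op K \<eta> \<epsilon> R \<sigma>
           (\<lambda>y. of_real (indicator Q y * monomial Q j y)) x)))\<^sup>2 \<partial>\<omega>))"

definition poisson_int :: "real \<Rightarrow> real set \<Rightarrow> real measure \<Rightarrow> ennreal" where
  "poisson_int \<alpha> Q \<mu> =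
     (\<integral>\<^sup>+ x. ennreal ((side Q / (side Q + \<bar>x - center Q\<bar>)\<^sup>2) powr (1 - \<alpha>)) \<partial>\<mu>)"

definition A2_const :: "real \<Rightarrow> real measure \<Rightarrow> real measure \<Rightarrow> ennreal" where
  "A2_const \<alpha> \<sigma> \<omega> =
     (SUP Q\<in>cubes. poisson_int \<alpha> Q \<sigma> * (emeasure \<omega> Q / ennreal (side Q powr (1 - \<alpha>))))"

end

theory Submission
  imports Defs
begin

text \<open>
  On a cube \<open>Q\<close> with left endpoint \<open>a\<close> and length \<open>\<ell>\<close>, the monomial \<open>m\<^sub>j\<close> with \<open>j \<ge> 1\<close> is
  \<open>(- 1 / 2) ^ j + \<integral> w t * 1[t \<le> y] dt\<close> with \<open>\<bar>w\<bar> \<le> 1 / \<ell>\<close>. Hence \<open>T (1\<^sub>Q m\<^sub>j)\<close> is dominated by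
  half of \<open>\<bar>T 1\<^sub>Q\<bar>\<close> plus the average over \<open>t \<in> Q\<close> of \<open>\<bar>T 1\<^bsub>Q \<inter> {t..}\<^esub>\<bar>\<close>. On \<open>Q \<inter> {t..}\<close>
  itself this is controlled by testing on indicators, with total factor \<open>1 / 2 + 1 \<le> 2 \<le> \<kappa>!\<close>. For a
  single \<open>t\<close> the remaining part, on \<open>x < t\<close>, is not controlled by the Muckenhoupt constant
  because of a logarithmic divergence at \<open>t\<close>; averaging over \<open>t\<close> removes it. Integrating first
  in \<open>t\<close> produces, with \<open>u = y - x\<close> and \<open>v = z - x\<close>, the kernel
  \<open>(u v) powr (\<alpha> - 1) * min u v \<le> max u v powr (2 \<alpha> - 1)\<close>, and summing over the dyadic scales
  \<open>max u v \<approx> \<ell> / 2 ^ k\<close> gives a geometric series of local Muckenhoupt products.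
\<close>

section \<open>Squares, square roots and Minkowski's inequality in \<open>ennreal\<close>\<close>

lemma ennreal_power2_le_imp_le:
  fixes a b :: ennreal
  assumes "a\<^sup>2 \<le> b\<^sup>2"
  shows "a \<le> b"
proof (rule ccontr)
  assume "\<not> a \<le> b"
  then have ba: "b < a" by simp
  then obtain r where r: "b = ennreal r" "r \<ge> 0" by (cases b) auto
  show False
  proof (cases a)
    case (real s)
    then have "r < s" using ba r by (simp add: ennreal_less_iff)
    then have "r\<^sup>2 < s\<^sup>2" using r by (simp add: power_strict_mono)
    moreover have "ennreal (s\<^sup>2) \<le> ennreal (r\<^sup>2)" using assms real r by (simp add: ennreal_power)
    ultimately show False using r by (simp add: ennreal_le_iff)
  next
    case top
    then show False using assms r by (simp add: ennreal_power top_unique)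
  qed
qed

lemma enn_sqrt_power2: "(enn_sqrt x)\<^sup>2 = x"
proof (cases x)
  case (real r)
  then show ?thesis by (simp add: enn_sqrt_def ennreal_power)
next
  case top
  then show ?thesis by (simp add: enn_sqrt_def power2_eq_square ennreal_mult_top)
qed

lemma enn_sqrt_leI: "x \<le> y\<^sup>2 \<Longrightarrow> enn_sqrt x \<le> y"
  by (rule ennreal_power2_le_imp_le) (simp add: enn_sqrt_power2)

text \<open>The cross term of the expanded square is bounded by Cauchy-Schwarz. Norms enter only
  through squared upper bounds, so \<open>p\<close> and \<open>q\<close> may be infinite and no
  roots of integrals appear.\<close>

lemma nn_integral_Minkowski2:
  fixes p q :: ennreal
  assumes [measurable]: "f \<in> borel_measurable M" "g \<in> borel_measurable M"
    and f: "(\<integral>\<^sup>+x. (f x)\<^sup>2 \<partial>M) \<le> p\<^sup>2" and g: "(\<integral>\<^sup>+x. (g x)\<^sup>2 \<partial>M) \<le> q\<^sup>2"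
  shows "(\<integral>\<^sup>+x. (f x + g x)\<^sup>2 \<partial>M) \<le> (p + q)\<^sup>2"
proof -
  have "(\<integral>\<^sup>+x. f x * g x \<partial>M)\<^sup>2 \<le> (\<integral>\<^sup>+x. (f x)\<^sup>2 \<partial>M) * (\<integral>\<^sup>+x. (g x)\<^sup>2 \<partial>M)"
    by (rule Cauchy_Schwarz_nn_integral) auto
  also have "\<dots> \<le> (p * q)\<^sup>2" using f g by (auto simp: power_mult_distrib intro!: mult_mono)
  finally have fg: "(\<integral>\<^sup>+x. f x * g x \<partial>M) \<le> p * q" by (rule ennreal_power2_le_imp_le)
  have "(\<integral>\<^sup>+x. (f x + g x)\<^sup>2 \<partial>M) = (\<integral>\<^sup>+x. (f x)\<^sup>2 + (2 * (f x * g x) + (g x)\<^sup>2) \<partial>M)"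
    by (simp add: power2_sum ac_simps)
  also have "\<dots> = (\<integral>\<^sup>+x. (f x)\<^sup>2 \<partial>M) + (2 * (\<integral>\<^sup>+x. f x * g x \<partial>M) + (\<integral>\<^sup>+x. (g x)\<^sup>2 \<partial>M))"
    by (simp add: nn_integral_add nn_integral_cmult)
  also have "\<dots> \<le> p\<^sup>2 + (2 * (p * q) + q\<^sup>2)" using f g fg by (intro add_mono mult_left_mono) auto
  also have "\<dots> = (p + q)\<^sup>2" by (simp add: power2_sum ac_simps)
  finally show ?thesis .
qed

section \<open>Locally finite measures and cubes on the line\<close>

lemma locally_finite_emeasure_bounded:
  assumes "locally_finite_borel \<mu>" "bounded S"
  shows "emeasure \<mu> S < \<infinity>"
proof -
  have s: "sets \<mu> = sets borel" using assms by (simp add: locally_finite_borel_def)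
  obtain U where U: "\<And>x. open (U x) \<and> x \<in> U x \<and> emeasure \<mu> (U x) < \<infinity>"
    using assms(1) unfolding locally_finite_borel_def by metis
  have "compact (closure S)" using assms(2) by (simp add: compact_closure)
  then obtain F where F: "finite F" "closure S \<subseteq> (\<Union>x\<in>F. U x)"
    by (rule compactE_image[of _ "UNIV" U]) (use U in auto)
  have "emeasure \<mu> S \<le> emeasure \<mu> (\<Union>x\<in>F. U x)"
    using F closure_subset[of S] U by (intro emeasure_mono) (auto simp: s)
  also have "\<dots> \<le> (\<Sum>x\<in>F. emeasure \<mu> (U x))"
    using F U by (intro emeasure_subadditive_finite) (auto simp: s)
  also have "\<dots> < \<infinity>" using F U by (auto simp: less_top)
  finally show ?thesis .
qed

lemma locally_finite_sigma_finite:
  assumes "locally_finite_borel \<mu>"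
  shows "sigma_finite_measure \<mu>"
proof
  have s: "sets \<mu> = sets borel" using assms by (simp add: locally_finite_borel_def)
  then have sp: "space \<mu> = UNIV" by (metis sets_eq_imp_space_eq space_borel)
  show "\<exists>A. countable A \<and> A \<subseteq> sets \<mu> \<and> \<Union>A = space \<mu> \<and> (\<forall>a\<in>A. emeasure \<mu> a \<noteq> \<infinity>)"
  proof (intro exI[of _ "range (\<lambda>n::nat. cball (0::real) n)"] conjI)
    show "\<Union> (range (\<lambda>n::nat. cball (0::real) n)) = space \<mu>"
      using real_arch_simple by (auto simp: sp)
    show "\<forall>a\<in>range (\<lambda>n::nat. cball (0::real) n). emeasure \<mu> a \<noteq> \<infinity>"
      using locally_finite_emeasure_bounded[OF assms] by (metis bounded_cball imageE less_irrefl)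
  qed (auto simp: s)
qed

lemma cube_endpoints:
  assumes "Q \<in> cubes"
  shows "Inf Q < Sup Q" "{Inf Q<..<Sup Q} \<subseteq> Q" "Q \<subseteq> {Inf Q..Sup Q}" "Q \<in> sets borel"
    "side Q = Sup Q - Inf Q"
proof -
  have Q: "is_interval Q" "bounded Q" "interior Q \<noteq> {}" using assms by (auto simp: cubes_def)
  then have ne: "Q \<noteq> {}" by auto
  have bd: "bdd_above Q" "bdd_below Q"
    using Q bounded_imp_bdd_above bounded_imp_bdd_below by auto
  show sub: "Q \<subseteq> {Inf Q..Sup Q}" using bd by (auto intro: cInf_lower cSup_upper)
  show sup: "{Inf Q<..<Sup Q} \<subseteq> Q"
  proof
    fix x assume "x \<in> {Inf Q<..<Sup Q}"
    then obtain p q where "p \<in> Q" "p < x" "q \<in> Q" "x < q"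
      using less_cSup_iff[OF ne bd(1)] cInf_less_iff[OF ne bd(2)] by auto
    then show "x \<in> Q" using Q(1) unfolding is_interval_1 by (meson less_imp_le)
  qed
  show lt: "Inf Q < Sup Q"
  proof (rule ccontr)
    assume "\<not> Inf Q < Sup Q"
    then have "{Inf Q..Sup Q} \<subseteq> {Inf Q}" by auto
    then have "interior Q \<subseteq> interior {Inf Q}" using sub by (meson interior_mono order_trans)
    then show False using Q(3) by simp
  qed
  show b: "Q \<in> sets borel" using Q(1) real_interval_borel_measurable by blast
  have "emeasure lborel {Inf Q<..<Sup Q} \<le> emeasure lborel Q"
    "emeasure lborel Q \<le> emeasure lborel {Inf Q..Sup Q}"
    using sub sup b by (auto intro!: emeasure_mono)
  then have "emeasure lborel Q = ennreal (Sup Q - Inf Q)" using lt by (simp add: antisym)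
  then show "side Q = Sup Q - Inf Q" using lt by (simp add: side_def measure_def)
qed

lemma cubes_Icc: "a < b \<Longrightarrow> {a..b::real} \<in> cubes"
  by (auto simp: cubes_def is_interval_cc)

text \<open>Tails of a cube must themselves be cubes for testing on indicators to apply to them. The
  strict inequality leaves room for an interior: the open interval from \<open>max t (Inf Q)\<close>
  to \<open>Sup Q\<close> lies in the tail.\<close>

lemma cubes_Int_atLeast:
  assumes Q: "Q \<in> cubes" and t: "t < Sup Q"
  shows "Q \<inter> {t..} \<in> cubes"
proof -
  define s where "s = max t (Inf Q)"
  have "s < Sup Q" using t cube_endpoints(1)[OF Q] by (simp add: s_def)
  then have "{s<..<Sup Q} \<noteq> {}" by simp
  moreover have "{s<..<Sup Q} \<subseteq> interior (Q \<inter> {t..})"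
    by (rule interior_maximal) (use cube_endpoints(2)[OF Q] in \<open>auto simp: s_def\<close>)
  ultimately have "interior (Q \<inter> {t..}) \<noteq> {}" by blast
  moreover have "is_interval (Q \<inter> {t..})" "bounded (Q \<inter> {t..})"
    using Q by (auto simp: cubes_def bounded_Int intro: is_interval_Int is_interval_ci)
  ultimately show ?thesis unfolding cubes_def by blast
qed

section \<open>Local Muckenhoupt products\<close>

text \<open>The Poisson weight of an interval is bounded below on the interval itself, so dropping
  the mass outside leaves a local product of the two weights. Centre and radius are explicit because
  the centre later becomes an integration variable.\<close>

lemma A2_const_interval:
  assumes \<alpha>: "0 \<le> \<alpha>" "\<alpha> < 1" and r: "r > 0"
    and \<sigma>: "sets \<sigma> = sets borel"
  shows "emeasure \<sigma> {z - r..z + r} * emeasure \<omega> {z - r..z + r}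
    \<le> ennreal (9 * r powr (2 - 2 * \<alpha>)) * A2_const \<alpha> \<sigma> \<omega>"
proof -
  define I where "I = {z - r..z + r}"
  have I: "I \<in> cubes" using r by (simp add: I_def cubes_Icc)
  have sd: "side I = 2 * r" using r by (simp add: I_def side_def)
  have c: "center I = z" using r by (simp add: I_def center_def)
  \<comment> \<open>\<open>w\<close> is the Poisson weight at the endpoints of \<open>I\<close>,
    where side plus distance is \<open>3 * r\<close>, and \<open>v\<close> is the normalisation of
    the \<omega>-mass. Their quotient \<open>v / w\<close> is
    \<open>(9 * (r * r)) powr (1 - \<alpha>)\<close>, whence the constant 9.\<close>
  define w where "w = (2 / (9 * r)) powr (1 - \<alpha>)"
  define v where "v = (2 * r) powr (1 - \<alpha>)"
  have "ennreal w * emeasure \<sigma> I = (\<integral>\<^sup>+x. ennreal w * indicator I x \<partial>\<sigma>)"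
    by (simp add: nn_integral_cmult_indicator I_def \<sigma>)
  also have "\<dots> \<le> poisson_int \<alpha> I \<sigma>"
    unfolding poisson_int_def
  proof (intro nn_integral_mono)
    fix x
    have "w \<le> (side I / (side I + \<bar>x - center I\<bar>)\<^sup>2) powr (1 - \<alpha>)" if "x \<in> I"
    proof -
      have x: "\<bar>x - z\<bar> \<le> r" using that by (auto simp: I_def)
      have "2 / (9 * r) = (2 * r) / (3 * r)\<^sup>2" using r by (simp add: power2_eq_square)
      also have "\<dots> \<le> (2 * r) / (2 * r + \<bar>x - z\<bar>)\<^sup>2"
        using x r by (intro divide_left_mono power_mono mult_pos_pos) (auto simp: zero_less_power2)
      finally show ?thesis using \<alpha> r unfolding w_def sd c by (intro powr_mono2) auto
    qed
    then show "ennreal w * indicator I x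
        \<le> ennreal ((side I / (side I + \<bar>x - center I\<bar>)\<^sup>2) powr (1 - \<alpha>))"
      by (auto simp: indicator_def intro: ennreal_leI)
  qed
  finally have P: "ennreal w * emeasure \<sigma> I \<le> poisson_int \<alpha> I \<sigma>" .
  have vp: "v > 0" "w > 0" using r by (auto simp: v_def w_def)
  have wv: "v / w \<le> 9 * r powr (2 - 2 * \<alpha>)"
  proof -
    have "v / w = ((2 * r) / (2 / (9 * r))) powr (1 - \<alpha>)"
      unfolding v_def w_def by (rule powr_divide[symmetric])
    also have "(2 * r) / (2 / (9 * r)) = 9 * (r * r)" using r by simp
    also have "(9 * (r * r)) powr (1 - \<alpha>) = 9 powr (1 - \<alpha>) * (r * r) powr (1 - \<alpha>)"
      by (rule powr_mult)
    also have "(r * r) powr (1 - \<alpha>) = r powr (2 - 2 * \<alpha>)"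
    proof -
      have "(r * r) powr (1 - \<alpha>) = r powr (1 - \<alpha>) * r powr (1 - \<alpha>)"
        by (rule powr_mult)
      also have "\<dots> = r powr ((1 - \<alpha>) + (1 - \<alpha>))" by (rule powr_add[symmetric])
      finally show ?thesis by (simp add: algebra_simps)
    qed
    also have "9 powr (1 - \<alpha>) \<le> 9 powr (1::real)" using \<alpha> by (intro powr_mono) auto
    finally show ?thesis by (simp add: mult_right_mono)
  qed
  have "ennreal w * emeasure \<sigma> I * (emeasure \<omega> I / ennreal v) \<le> A2_const \<alpha> \<sigma> \<omega>"
  proof -
    have "ennreal w * emeasure \<sigma> I * (emeasure \<omega> I / ennreal v)
      \<le> poisson_int \<alpha> I \<sigma> * (emeasure \<omega> I / ennreal (side I powr (1 - \<alpha>)))"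
      using P by (auto simp: sd v_def intro!: mult_mono)
    also have "\<dots> \<le> A2_const \<alpha> \<sigma> \<omega>" unfolding A2_const_def by (rule SUP_upper[OF I])
    finally show ?thesis .
  qed
  then have "ennreal (v / w) * (ennreal w * emeasure \<sigma> I * (emeasure \<omega> I / ennreal v))
      \<le> ennreal (9 * r powr (2 - 2 * \<alpha>)) * A2_const \<alpha> \<sigma> \<omega>"
    using wv by (intro mult_mono ennreal_leI) auto
  moreover have "ennreal (v / w) * (ennreal w * emeasure \<sigma> I * (emeasure \<omega> I / ennreal v))
      = (ennreal (v / w) * ennreal w * inverse (ennreal v)) * (emeasure \<sigma> I * emeasure \<omega> I)"
    unfolding divide_ennreal_def by (simp only: mult_ac)
  moreover have "ennreal (v / w) * ennreal w * inverse (ennreal v) = 1"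
    using vp by (simp add: inverse_ennreal flip: ennreal_mult)
  ultimately show ?thesis by (simp add: I_def)
qed

section \<open>Continuity and size of the truncated kernels\<close>

text \<open>For \<open>k = 0\<close> the smoothness condition is itself a Hoelder bound of exponent
  \<delta>; for \<open>k > 0\<close> the bound on the first derivative makes the kernel Lipschitz,
  with exponent 1. Constants uniform in \<open>y\<close> near \<open>y0\<close> are what joint
  continuity needs.\<close>

lemma kernel_bounds_uniformly_Hoelder:
  fixes L :: "real \<Rightarrow> real \<Rightarrow> 'a::real_normed_vector"
  assumes L: "kernel_bounds \<alpha> k \<delta> C L" and "\<delta> > 0" and ne: "x0 \<noteq> y0"
  obtains M \<gamma> d where "\<gamma> > 0" "d > 0"
    "\<And>x y. \<lbrakk>\<bar>x - x0\<bar> \<le> d; \<bar>y - y0\<bar> \<le> d\<rbrakk> \<Longrightarrow> norm (L x y - L x0 y) \<le> M * \<bar>x - x0\<bar> powr \<gamma>"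
proof -
  \<comment> \<open>A quarter of the distance keeps \<open>\<bar>x - y\<bar>\<close> between
    \<open>2 * d\<close> and \<open>6 * d\<close> for all nearby points, and a displacement of at
    most \<open>d\<close> stays within half the distance, as the smoothness condition
    requires.\<close>
  define d where "d = \<bar>x0 - y0\<bar> / 4"
  have d: "d > 0" using ne by (simp add: d_def)
  have far: "\<bar>x - y\<bar> \<in> {2 * d..6 * d}" if "\<bar>x - x0\<bar> \<le> d" "\<bar>y - y0\<bar> \<le> d" for x y
    using that by (auto simp: d_def abs_if split: if_splits)
  have bounded_powr: "\<exists>B\<ge>0. \<forall>t\<in>{2 * d..6 * d}. t powr p \<le> B" for p
  proof -
    \<comment> \<open>The exponent can have either sign, so the larger of the two endpoint values is
      taken.\<close>
    have "t powr p \<le> max ((2 * d) powr p) ((6 * d) powr p)" if "t \<in> {2 * d..6 * d}" for t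
      using that d by (cases "p \<ge> 0") (auto simp: le_max_iff_disj intro: powr_mono2 powr_mono2')
    then show ?thesis by (intro exI[of _ "max ((2 * d) powr p) ((6 * d) powr p)"]) (auto simp: le_max_iff_disj)
  qed
  show thesis
  proof (cases k)
    case 0
    obtain B where B: "B \<ge> 0" "\<And>t. t \<in> {2 * d..6 * d} \<Longrightarrow> t powr (\<alpha> - 1) \<le> B"
      using bounded_powr by blast
    have "norm (L x y - L x0 y) \<le> (\<bar>C\<bar> * B * (1 / (2 * d)) powr \<delta>) * \<bar>x - x0\<bar> powr \<delta>"
      if xy: "\<bar>x - x0\<bar> \<le> d" "\<bar>y - y0\<bar> \<le> d" for x y
    proof -
      have r: "\<bar>x0 - y\<bar> \<in> {2 * d..6 * d}" using far[of x0 y] xy d by simp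
      have q: "\<bar>x0 - x\<bar> / \<bar>x0 - y\<bar> \<le> \<bar>x - x0\<bar> / (2 * d)"
        using r d by (simp add: abs_minus_commute frac_le)
      also have "\<dots> \<le> 1 / 2" using xy d by (simp add: field_simps)
      finally have h: "\<bar>x0 - x\<bar> / \<bar>x0 - y\<bar> \<le> 1 / 2" .
      have "x0 \<noteq> y" using r d by auto
      then have "norm (L x0 y - L x y)
          \<le> C * (\<bar>x0 - x\<bar> / \<bar>x0 - y\<bar>) powr \<delta> * \<bar>x0 - y\<bar> powr (\<alpha> - 1)"
        using L h 0 unfolding kernel_bounds_def by (auto simp: iter_deriv_def)
      also have "\<dots> \<le> \<bar>C\<bar> * (\<bar>x - x0\<bar> / (2 * d)) powr \<delta> * B"
        using B r q \<open>\<delta> > 0\<close> by (intro mult_mono powr_mono2) auto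
      also have "(\<bar>x - x0\<bar> / (2 * d)) powr \<delta> = \<bar>x - x0\<bar> powr \<delta> * (1 / (2 * d)) powr \<delta>"
        by (simp flip: powr_mult)
      finally show ?thesis by (simp add: norm_minus_commute mult_ac)
    qed
    then show thesis using that \<open>\<delta> > 0\<close> d by blast
  next
    case (Suc k')
    obtain B where B: "B \<ge> 0" "\<And>t. t \<in> {2 * d..6 * d} \<Longrightarrow> t powr (\<alpha> - 2) \<le> B"
      using bounded_powr by blast
    have "norm (L x y - L x0 y) \<le> (\<bar>C\<bar> * B) * \<bar>x - x0\<bar> powr 1"
      if xy: "\<bar>x - x0\<bar> \<le> d" "\<bar>y - y0\<bar> \<le> d" for x y
    proof -
      let ?D = "\<lambda>z. vector_derivative (\<lambda>t. L t y) (at z)"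
      have "norm (L x y - L x0 y) \<le> (\<bar>C\<bar> * B) * norm (x - x0)"
      \<comment> \<open>Mean value inequality on \<open>cball x0 d\<close>, all of whose points stay
        away from \<open>y\<close>.\<close>
      proof (rule differentiable_bound[of "cball x0 d" _ "\<lambda>z h. h *\<^sub>R ?D z"])
        fix z assume "z \<in> cball x0 d"
        then have r: "\<bar>z - y\<bar> \<in> {2 * d..6 * d}"
          using far[of z y] xy by (simp add: dist_real_def abs_minus_commute[of x0 z])
        then have zy: "z \<noteq> y" using d by auto
        have diffj: "\<forall>j<k. iter_deriv j (\<lambda>t. L t y) differentiable (at z)"
          using L zy unfolding kernel_bounds_def by blast
        have "(\<lambda>t. L t y) differentiable (at z)"
          using spec[OF diffj, of 0] Suc by (simp add: iter_deriv_def)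
        then show "((\<lambda>t. L t y) has_derivative (\<lambda>h. h *\<^sub>R ?D z)) (at z within cball x0 d)"
          by (simp add: vector_derivative_works has_vector_derivative_def has_derivative_at_withinI)
        have bnd: "\<forall>j\<le>k. norm (iter_deriv j (\<lambda>t. L t y) z) \<le> C * \<bar>z - y\<bar> powr (\<alpha> - real j - 1)"
          using L zy unfolding kernel_bounds_def by blast
        have "norm (?D z) \<le> C * \<bar>z - y\<bar> powr (\<alpha> - 2)"
          using spec[OF bnd, of 1] Suc by (simp add: iter_deriv_def)
        also have "\<dots> \<le> \<bar>C\<bar> * B" using B r by (intro mult_mono) auto
        finally show "onorm (\<lambda>h. h *\<^sub>R ?D z) \<le> \<bar>C\<bar> * B"
          by (simp add: onorm_scaleR_left onorm_id)
      qed (use xy d in \<open>auto simp: dist_real_def\<close>)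
      then show ?thesis by simp
    qed
    then show thesis using that d by (meson zero_less_one)
  qed
qed

lemma powr_abs_tendsto_0:
  fixes f :: "'b \<Rightarrow> real"
  assumes "(f \<longlongrightarrow> c) F" "\<gamma> > 0"
  shows "((\<lambda>z. M * \<bar>f z - c\<bar> powr \<gamma>) \<longlongrightarrow> 0) F"
proof -
  have "((\<lambda>z. \<bar>f z - c\<bar>) \<longlongrightarrow> \<bar>c - c\<bar>) F" by (intro tendsto_intros assms)
  then have "((\<lambda>z. \<bar>f z - c\<bar> powr \<gamma>) \<longlongrightarrow> 0 powr \<gamma>) F"
    using \<open>\<gamma> > 0\<close> by (intro tendsto_powr2) auto
  then show ?thesis using tendsto_mult_right_zero by fastforce
qed

text \<open>The path from \<open>(x, y)\<close> through \<open>(x0, y)\<close> to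
  \<open>(x0, y0)\<close> changes one variable at a time: the first leg is controlled uniformly in
  \<open>y\<close>, the second by the adjoint condition. Joint continuity yields measurability of
  the kernel on the product space.\<close>

lemma standard_kernel_isCont:
  fixes L :: "real \<Rightarrow> real \<Rightarrow> 'a::real_normed_vector"
  assumes L: "standard_kernel \<alpha> k1 k2 \<delta> C L" and "\<delta> > 0" and ne: "x0 \<noteq> y0"
  shows "isCont (\<lambda>(x, y). L x y) (x0, y0)"
proof -
  have L1: "kernel_bounds \<alpha> k1 \<delta> C L" and L2: "kernel_bounds \<alpha> k2 \<delta> C (\<lambda>x y. L y x)"
    using L by (auto simp: standard_kernel_def)
  obtain M \<gamma> d where 1: "\<gamma> > 0" "d > 0"
    "\<And>x y. \<lbrakk>\<bar>x - x0\<bar> \<le> d; \<bar>y - y0\<bar> \<le> d\<rbrakk> \<Longrightarrow> norm (L x y - L x0 y) \<le> M * \<bar>x - x0\<bar> powr \<gamma>"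
    by (rule kernel_bounds_uniformly_Hoelder[OF L1 \<open>\<delta> > 0\<close> ne]) (rule that)
  obtain M' \<gamma>' d' where 2: "\<gamma>' > 0" "d' > 0"
    "\<And>y x. \<lbrakk>\<bar>y - y0\<bar> \<le> d'; \<bar>x - x0\<bar> \<le> d'\<rbrakk> \<Longrightarrow> norm (L x y - L x y0) \<le> M' * \<bar>y - y0\<bar> powr \<gamma>'"
    by (rule kernel_bounds_uniformly_Hoelder[OF L2 \<open>\<delta> > 0\<close> ne[symmetric]]) (rule that)
  define e where "e = min d d'"
  have "((\<lambda>z. L (fst z) (snd z) - L x0 y0) \<longlongrightarrow> 0) (at (x0, y0))"
  proof (rule Lim_null_comparison)
    have "eventually (\<lambda>z. dist z (x0, y0) < e) (at (x0, y0))"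
      using 1(2) 2(2) unfolding eventually_at by (intro exI[of _ e]) (simp add: e_def)
    then show "eventually (\<lambda>z. norm (L (fst z) (snd z) - L x0 y0)
        \<le> M * \<bar>fst z - x0\<bar> powr \<gamma> + M' * \<bar>snd z - y0\<bar> powr \<gamma>') (at (x0, y0))"
    proof eventually_elim
      case (elim z)
      have b: "\<bar>fst z - x0\<bar> \<le> e" "\<bar>snd z - y0\<bar> \<le> e"
        using elim dist_fst_le[of z "(x0, y0)"] dist_snd_le[of z "(x0, y0)"]
        by (auto simp: dist_real_def)
      have "norm (L (fst z) (snd z) - L x0 y0)
          \<le> norm (L (fst z) (snd z) - L x0 (snd z)) + norm (L x0 (snd z) - L x0 y0)"
        by norm
      also have "\<dots> \<le> M * \<bar>fst z - x0\<bar> powr \<gamma> + M' * \<bar>snd z - y0\<bar> powr \<gamma>'"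
        using b 1(2) 2(2) by (intro add_mono 1(3) 2(3)) (auto simp: e_def)
      finally show ?case .
    qed
    have "((\<lambda>z. M * \<bar>fst z - x0\<bar> powr \<gamma>) \<longlongrightarrow> 0) (at (x0, y0))"
      using tendsto_fst[OF tendsto_ident_at, of "(x0, y0)" UNIV] 1(1)
      by (intro powr_abs_tendsto_0) auto
    moreover have "((\<lambda>z. M' * \<bar>snd z - y0\<bar> powr \<gamma>') \<longlongrightarrow> 0) (at (x0, y0))"
      using tendsto_snd[OF tendsto_ident_at, of "(x0, y0)" UNIV] 2(1)
      by (intro powr_abs_tendsto_0) auto
    ultimately show "((\<lambda>z. M * \<bar>fst z - x0\<bar> powr \<gamma> + M' * \<bar>snd z - y0\<bar> powr \<gamma>') \<longlongrightarrow> 0)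
        (at (x0, y0))"
      using tendsto_add by fastforce
  qed
  then show ?thesis
    by (simp add: isCont_def case_prod_beta LIM_zero_cancel)
qed

text \<open>On the diagonal the bound holds because \<open>0 powr (\<alpha> - 1) = 0\<close>.\<close>

lemma truncated_kernel_properties:
  fixes K :: "real \<Rightarrow> real \<Rightarrow> 'a::{real_normed_field,banach,second_countable_topology}"
  assumes \<alpha>: "\<alpha> < 1" and op: "fractional_CZ_operator \<alpha> C K \<eta>" and tr: "(\<epsilon>, R) \<in> truncations"
  shows "(\<lambda>(x, y). truncated_kernel \<eta> K \<epsilon> R x y) \<in> borel_measurable (borel \<Otimes>\<^sub>M borel)"
    and "\<And>x y. norm (truncated_kernel \<eta> K \<epsilon> R x y) \<le> \<bar>C\<bar> * \<bar>x - y\<bar> powr (\<alpha> - 1)"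
    and "\<exists>B. \<forall>x y. norm (truncated_kernel \<eta> K \<epsilon> R x y) \<le> B"
proof -
  let ?L = "truncated_kernel \<eta> K \<epsilon> R"
  obtain k1 k2 \<delta> where "\<delta> > 0" and std: "standard_kernel \<alpha> k1 k2 \<delta> C ?L"
    and \<eta>: "truncation_function \<epsilon> R (\<eta> \<epsilon> R)"
    using op tr unfolding fractional_CZ_operator_def by blast
  obtain a where a: "a > 0" "\<And>t. \<lbrakk>0 \<le> t; t < a\<rbrakk> \<Longrightarrow> \<eta> \<epsilon> R t = 0"
    using \<eta> unfolding truncation_function_def by auto
  have diag: "?L x y = 0" if "\<bar>x - y\<bar> < a" for x y
    using a(2)[of "\<bar>x - y\<bar>"] that by (simp add: truncated_kernel_def)
  have "isCont (\<lambda>(x, y). ?L x y) (x0, y0)" for x0 y0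
  proof (cases "x0 = y0")
    case False
    then show ?thesis using standard_kernel_isCont[OF std \<open>\<delta> > 0\<close>] by blast
  next
    case True
    \<comment> \<open>On the strip \<open>\<bar>x - y\<bar> < a\<close> around the diagonal the
      truncation makes the kernel vanish, so it is locally constant there.\<close>
    have "open ((\<lambda>z. \<bar>fst z - snd z\<bar>) -` {..<a} :: (real \<times> real) set)"
      by (intro open_vimage continuous_intros)
    then have "eventually (\<lambda>z. z \<in> (\<lambda>z. \<bar>fst z - snd z\<bar>) -` {..<a}) (nhds (x0, y0))"
      using True a(1) by (intro eventually_nhds_in_open) auto
    then have "eventually (\<lambda>z. (\<lambda>(x, y). ?L x y) z = 0) (nhds (x0, y0))"
      by eventually_elim (auto simp: diag)
    then show ?thesis using isCont_cong[of _ "\<lambda>_. 0"] by fastforce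
  qed
  then have "continuous_on UNIV (\<lambda>(x, y). ?L x y)"
    by (auto intro: continuous_at_imp_continuous_on)
  then show "(\<lambda>(x, y). ?L x y) \<in> borel_measurable (borel \<Otimes>\<^sub>M borel)"
    using borel_measurable_continuous_onI by (simp add: borel_prod)
  show bd: "norm (?L x y) \<le> \<bar>C\<bar> * \<bar>x - y\<bar> powr (\<alpha> - 1)" for x y
  proof (cases "x = y")
    case False
    then have "\<forall>j\<le>k1. norm (iter_deriv j (\<lambda>t. ?L t y) x) \<le> C * \<bar>x - y\<bar> powr (\<alpha> - real j - 1)"
      using std unfolding standard_kernel_def kernel_bounds_def by blast
    then have "norm (?L x y) \<le> C * \<bar>x - y\<bar> powr (\<alpha> - 1)"
      by (auto simp: iter_deriv_def dest: spec[of _ 0])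
    also have "\<dots> \<le> \<bar>C\<bar> * \<bar>x - y\<bar> powr (\<alpha> - 1)" by (intro mult_right_mono) auto
    finally show ?thesis .
  qed (use diag[of y y] a in simp)
  have "norm (?L x y) \<le> \<bar>C\<bar> * a powr (\<alpha> - 1)" for x y
  proof (cases "\<bar>x - y\<bar> < a")
    case False
    then have "\<bar>x - y\<bar> powr (\<alpha> - 1) \<le> a powr (\<alpha> - 1)" using a \<alpha> by (intro powr_mono2') auto
    then show ?thesis using bd[of x y] by (meson abs_ge_zero mult_left_mono order_trans)
  qed (simp add: diag)
  then show "\<exists>B. \<forall>x y. norm (?L x y) \<le> B" by blast
qed

section \<open>Elementary inequalities for powers at dyadic scales\<close>

text \<open>The factor \<open>min u v\<close> raises the exponent of the smaller variable from
  \<open>\<alpha> - 1\<close> to \<alpha>, which is nonnegative, so this variable may be replaced by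
  the larger one. This is the gain from integrating in the cut point first.\<close>

lemma powr_mult_min_le_max:
  fixes u v \<alpha> :: real
  assumes "0 \<le> \<alpha>" "0 < u" "0 < v"
  shows "u powr (\<alpha> - 1) * v powr (\<alpha> - 1) * min u v \<le> max u v powr (2 * \<alpha> - 1)"
proof -
  have *: "p powr (\<alpha> - 1) * q powr (\<alpha> - 1) * p \<le> q powr (2 * \<alpha> - 1)" if "0 < p" "p \<le> q" for p q :: real
  proof -
    have "p powr (\<alpha> - 1) * p = p powr \<alpha>" using that by (simp add: powr_mult_base mult.commute)
    then have "p powr (\<alpha> - 1) * q powr (\<alpha> - 1) * p = p powr \<alpha> * q powr (\<alpha> - 1)"
      by (metis mult.commute mult.left_commute)
    also have "\<dots> \<le> q powr \<alpha> * q powr (\<alpha> - 1)"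
      using that assms by (intro mult_right_mono powr_mono2) auto
    also have "\<dots> = q powr (2 * \<alpha> - 1)" by (simp flip: powr_add)
    finally show ?thesis .
  qed
  show ?thesis
    using *[of u v] *[of v u] assms by (cases "u \<le> v") (auto simp: mult_ac)
qed

text \<open>Meant for the exponent \<open>2 * \<alpha> - 1\<close>, which can have either sign. A
  negative exponent is at least -1, so passing from \<open>R / 2\<close> to \<open>R\<close> costs
  at most the factor 2.\<close>

lemma powr_dyadic_le:
  fixes m R p :: real
  assumes "R / 2 < m" "m \<le> R" "-1 \<le> p" "0 < R"
  shows "m powr p \<le> 2 * R powr p"
proof (cases "p \<ge> 0")
  case True
  then have "m powr p \<le> R powr p" using assms by (intro powr_mono2) auto
  also have "\<dots> \<le> 2 * R powr p" by simp
  finally show ?thesis .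
next
  case False
  then have "m powr p \<le> (R / 2) powr p" using assms by (intro powr_mono2') auto
  also have "\<dots> = 2 powr (- p) * R powr p" by (simp add: powr_divide powr_minus field_simps)
  also have "\<dots> \<le> 2 powr 1 * R powr p"
    using assms by (intro mult_right_mono powr_mono) auto
  finally show ?thesis by simp
qed

lemma dyadic_scale_exists:
  fixes l m :: real
  assumes "0 < m" "m \<le> l"
  obtains k where "l / 2 ^ k / 2 < m" "m \<le> l / 2 ^ k"
proof -
  obtain n where n: "l / m < 2 ^ n" using real_arch_pow[of 2 "l / m"] by auto
  \<comment> \<open>The scale sought is the one just before the first \<open>l / 2 ^ n\<close> below
    \<open>m\<close>; \<open>m \<le> l\<close> makes \<open>N\<close> positive.\<close>
  define N where "N = (LEAST n. l / 2 ^ n < m)"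
  have ex: "l / 2 ^ n < m" using n assms by (simp add: field_simps)
  have N: "l / 2 ^ N < m" unfolding N_def by (rule LeastI[of "\<lambda>n. l / 2 ^ n < m", OF ex])
  then obtain k where k: "N = Suc k" using assms by (cases N) auto
  then have "\<not> l / 2 ^ k < m" using not_less_Least[of k "\<lambda>n. l / 2 ^ n < m"] by (simp add: N_def)
  then show thesis using that[of k] N k by (simp add: mult.commute)
qed

section \<open>Tail operators to the left of the cut point\<close>

text \<open>The locale collects the properties of a single truncation. The bound in
  \<open>L_bounded\<close> may depend on the truncation and serves only for integrability; the
  estimates themselves see only \<open>c\<close> from \<open>L_size\<close>.\<close>

locale two_weight_kernel =
  fixes \<sigma> \<omega> :: "real measure" and \<alpha> c :: real
    and L :: "real \<Rightarrow> real \<Rightarrow> 'a::{real_normed_field,banach,second_countable_topology}"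
  assumes \<sigma>: "locally_finite_borel \<sigma>" and \<omega>: "locally_finite_borel \<omega>"
    and \<alpha>: "0 \<le> \<alpha>" "\<alpha> < 1" and c: "0 \<le> c"
    and L_borel: "(\<lambda>(x, y). L x y) \<in> borel_measurable (borel \<Otimes>\<^sub>M borel)"
    and L_size: "\<And>x y. norm (L x y) \<le> c * \<bar>x - y\<bar> powr (\<alpha> - 1)"
    and L_bounded: "\<exists>B. \<forall>x y. norm (L x y) \<le> B"
begin

lemma sets_weights [simp, measurable_cong]: "sets \<sigma> = sets borel" "sets \<omega> = sets borel"
  using \<sigma> \<omega> by (auto simp: locally_finite_borel_def)

lemma space_weights [simp]: "space \<sigma> = UNIV" "space \<omega> = UNIV"
  using sets_eq_imp_space_eq[OF sets_weights(1)] sets_eq_imp_space_eq[OF sets_weights(2)] by auto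

sublocale sigma: sigma_finite_measure \<sigma> by (rule locally_finite_sigma_finite[OF \<sigma>])
sublocale omega: sigma_finite_measure \<omega> by (rule locally_finite_sigma_finite[OF \<omega>])

lemma L_measurable [measurable (raw)]:
  assumes "f \<in> borel_measurable N" "g \<in> borel_measurable N"
  shows "(\<lambda>z. L (f z) (g z)) \<in> borel_measurable N"
proof -
  have "(\<lambda>z. (f z, g z)) \<in> N \<rightarrow>\<^sub>M borel \<Otimes>\<^sub>M borel" using assms by simp
  from measurable_compose[OF this L_borel] show ?thesis by simp
qed

text \<open>This is the truncated operator applied to the indicator of
  \<open>Q \<inter> {t..}\<close>; the cut point \<open>t\<close> is an argument because it is
  averaged over later.\<close>

definition tail_op :: "real set \<Rightarrow> real \<Rightarrow> real \<Rightarrow> 'a" where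
  "tail_op Q t x = (LINT y|\<sigma>. (if y \<in> Q \<and> t \<le> y then L x y else 0))"

lemma tail_op_measurable [measurable (raw)]:
  assumes [measurable]: "Q \<in> sets borel" "f \<in> borel_measurable N" "g \<in> borel_measurable N"
  shows "(\<lambda>z. tail_op Q (f z) (g z)) \<in> borel_measurable N"
  unfolding tail_op_def by measurable

lemma integrable_tail:
  assumes Q: "Q \<in> cubes"
  shows "integrable \<sigma> (\<lambda>y. if y \<in> Q \<and> t \<le> y then L x y else 0)"
proof -
  obtain B where B: "\<And>x y. norm (L x y) \<le> B" using L_bounded by blast
  then have "0 \<le> B" using norm_ge_zero order_trans by blast
  have [measurable]: "Q \<in> sets borel" by (rule cube_endpoints(4)[OF Q])
  show ?thesis
  proof (rule integrableI_bounded_set[where A = Q and B = B])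
    show "emeasure \<sigma> Q < \<infinity>"
      using locally_finite_emeasure_bounded[OF \<sigma>] Q by (simp add: cubes_def)
    show "AE y in \<sigma>. y \<in> Q \<longrightarrow> norm (if y \<in> Q \<and> t \<le> y then L x y else 0) \<le> B"
      using B \<open>0 \<le> B\<close> by (intro AE_I2) auto
  qed auto
qed

lemma norm_tail_op_le:
  assumes Q: "Q \<in> cubes" and x: "x < t"
  shows "ennreal (norm (tail_op Q t x))
    \<le> (\<integral>\<^sup>+y. (if y \<in> Q \<and> t \<le> y then ennreal (c * (y - x) powr (\<alpha> - 1)) else 0) \<partial>\<sigma>)"
proof -
  have "ennreal (norm (tail_op Q t x))
      \<le> (\<integral>\<^sup>+y. ennreal (norm (if y \<in> Q \<and> t \<le> y then L x y else 0)) \<partial>\<sigma>)"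
    unfolding tail_op_def by (rule integral_norm_bound_ennreal[OF integrable_tail[OF Q]])
  also have "\<dots> \<le> (\<integral>\<^sup>+y. (if y \<in> Q \<and> t \<le> y then ennreal (c * (y - x) powr (\<alpha> - 1)) else 0) \<partial>\<sigma>)"
  proof (intro nn_integral_mono)
    fix y
    have "\<bar>x - y\<bar> = y - x" if "t \<le> y" using that x by simp
    then show "ennreal (norm (if y \<in> Q \<and> t \<le> y then L x y else 0))
        \<le> (if y \<in> Q \<and> t \<le> y then ennreal (c * (y - x) powr (\<alpha> - 1)) else 0)"
      using L_size[of x y] by (auto intro!: ennreal_leI)
  qed
  finally show ?thesis .
qed

text \<open>The integrand is constant on \<open>x < t \<le> min y z\<close>, so integrating in
  \<open>t\<close> yields the factor \<open>min u v\<close> with \<open>u = y - x\<close> and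
  \<open>v = z - x\<close>. One scale comparable to \<open>max u v\<close> already gives the bound;
  the whole sum is taken because each of its terms constrains \<open>y\<close> and \<open>z\<close>
  separately.\<close>

lemma nn_integral_split_point_le:
  assumes R: "\<And>k. R k = l / 2 ^ k" and xyz: "x < y" "x < z" "y - x \<le> l" "z - x \<le> l"
  shows "(\<integral>\<^sup>+t. (if x < t \<and> t \<le> y \<and> t \<le> z
        then ennreal (c * (y - x) powr (\<alpha> - 1)) * ennreal (c * (z - x) powr (\<alpha> - 1)) else 0) \<partial>lborel)
    \<le> (\<Sum>k. ennreal (2 * c\<^sup>2 * R k powr (2 * \<alpha> - 1)) *
          (if y - x \<le> R k \<and> z - x \<le> R k then 1 else 0))"
    (is "?I \<le> suminf ?f")
proof -
  define u v where "u = y - x" and "v = z - x"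
  have uv: "0 < u" "0 < v" "max u v \<le> l" using xyz by (auto simp: u_def v_def)
  have "0 < max u v" using uv by simp
  then obtain k where k: "l / 2 ^ k / 2 < max u v" "max u v \<le> l / 2 ^ k"
    using uv(3) by (rule dyadic_scale_exists)
  have "?I = (\<integral>\<^sup>+t. ennreal (c * u powr (\<alpha> - 1) * (c * v powr (\<alpha> - 1))) * indicator {x<..min y z} t \<partial>lborel)"
    using c by (intro nn_integral_cong) (auto simp: u_def v_def indicator_def ennreal_mult)
  also have "\<dots> = ennreal (c * u powr (\<alpha> - 1) * (c * v powr (\<alpha> - 1))) * ennreal (min y z - x)"
    using xyz by (subst nn_integral_cmult_indicator) auto
  also have "\<dots> = ennreal (c * u powr (\<alpha> - 1) * (c * v powr (\<alpha> - 1)) * (min y z - x))"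
    using xyz c by (intro ennreal_mult[symmetric]) auto
  also have "\<dots> = ennreal (c\<^sup>2 * (u powr (\<alpha> - 1) * v powr (\<alpha> - 1) * min u v))"
    by (simp add: u_def v_def power2_eq_square min_diff_distrib_left mult_ac)
  also have "\<dots> \<le> ennreal (c\<^sup>2 * (2 * R k powr (2 * \<alpha> - 1)))"
  proof (intro ennreal_leI mult_left_mono)
    have "u powr (\<alpha> - 1) * v powr (\<alpha> - 1) * min u v \<le> max u v powr (2 * \<alpha> - 1)"
      using uv \<alpha> by (intro powr_mult_min_le_max) auto
    also have "\<dots> \<le> 2 * R k powr (2 * \<alpha> - 1)"
      using k \<alpha> uv by (intro powr_dyadic_le) (auto simp: R)
    finally show "u powr (\<alpha> - 1) * v powr (\<alpha> - 1) * min u v \<le> 2 * R k powr (2 * \<alpha> - 1)" .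
  qed simp
  also have "\<dots> = ?f k" using k by (simp add: R u_def v_def mult_ac)
  also have "\<dots> \<le> suminf ?f" using sum_le_suminf[of ?f "{k}"] by (simp add: summableI)
  finally show ?thesis .
qed

text \<open>Expanding the square into integrals in \<open>y\<close> and \<open>z\<close> and
  integrating in \<open>t\<close> first leaves, at each scale, the product of the two weights of an
  interval of radius \<open>R k\<close>. The result is linear in \<open>side Q\<close>, which the
  later average over \<open>t\<close> cancels.\<close>

lemma nn_integral_tail_op_off_diagonal:
  assumes Q: "Q \<in> cubes"
  shows "(\<integral>\<^sup>+t. \<integral>\<^sup>+x. (if x \<in> Q \<and> x < t then (ennreal (norm (tail_op Q t x)))\<^sup>2 else 0) \<partial>\<omega> \<partial>lborel)
    \<le> ennreal (36 * c\<^sup>2 * side Q) * A2_const \<alpha> \<sigma> \<omega> * emeasure \<sigma> Q"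
proof -
  define l where "l = side Q"
  define R where "R k = l / 2 ^ k" for k :: nat
  have l: "l > 0" using cube_endpoints(1,5)[OF Q] by (simp add: l_def)
  have Rp: "R k > 0" for k using l by (simp add: R_def)
  have Qm [measurable]: "Q \<in> sets borel" by (rule cube_endpoints(4)[OF Q])
  have Ql: "\<bar>p - q\<bar> \<le> l" if "p \<in> Q" "q \<in> Q" for p q
    using subsetD[OF cube_endpoints(3)[OF Q] that(1)] subsetD[OF cube_endpoints(3)[OF Q] that(2)]
    by (simp add: l_def cube_endpoints(5)[OF Q] abs_le_iff)
  define h where "h t x y = (if x \<in> Q \<and> y \<in> Q \<and> x < t \<and> t \<le> y
      then ennreal (c * (y - x) powr (\<alpha> - 1)) else 0)" for t x y
  have [measurable]: "(\<lambda>z. h (f z) (g z) (g' z)) \<in> borel_measurable N"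
    if [measurable]: "f \<in> borel_measurable N" "g \<in> borel_measurable N" "g' \<in> borel_measurable N"
    for f g g' :: "'z \<Rightarrow> real" and N unfolding h_def by measurable
  define w where "w k = ennreal (2 * c\<^sup>2 * R k powr (2 * \<alpha> - 1))" for k
  define e :: "nat \<Rightarrow> real \<Rightarrow> real \<Rightarrow> real \<Rightarrow> ennreal" where
    "e k x z y = w k * (if x \<in> Q \<and> y \<in> Q \<and> z \<in> Q \<and> x < y \<and> x < z \<and> y - x \<le> R k \<and> z - x \<le> R k
      then 1 else 0)" for k x z y
  have [measurable]: "(\<lambda>z. e k (f z) (g z) (g' z)) \<in> borel_measurable N"
    if [measurable]: "f \<in> borel_measurable N" "g \<in> borel_measurable N" "g' \<in> borel_measurable N"
    for f g g' :: "'z \<Rightarrow> real" and N k unfolding e_def by measurable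
  interpret lo: pair_sigma_finite \<omega> lborel ..
  interpret ls: pair_sigma_finite \<sigma> lborel ..
  interpret so: pair_sigma_finite \<sigma> \<omega> ..
  have "(\<integral>\<^sup>+t. \<integral>\<^sup>+x. (if x \<in> Q \<and> x < t then (ennreal (norm (tail_op Q t x)))\<^sup>2 else 0) \<partial>\<omega> \<partial>lborel)
      \<le> (\<integral>\<^sup>+t. \<integral>\<^sup>+x. (\<integral>\<^sup>+y. h t x y \<partial>\<sigma>)\<^sup>2 \<partial>\<omega> \<partial>lborel)"
  proof (intro nn_integral_mono)
    fix t x
    have "ennreal (norm (tail_op Q t x)) \<le> (\<integral>\<^sup>+y. h t x y \<partial>\<sigma>)" if "x \<in> Q" "x < t"
      using norm_tail_op_le[OF Q that(2)] that by (simp add: h_def)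
    then show "(if x \<in> Q \<and> x < t then (ennreal (norm (tail_op Q t x)))\<^sup>2 else 0)
        \<le> (\<integral>\<^sup>+y. h t x y \<partial>\<sigma>)\<^sup>2"
      by (auto intro: power_mono)
  qed
  also have "\<dots> = (\<integral>\<^sup>+t. \<integral>\<^sup>+x. \<integral>\<^sup>+z. \<integral>\<^sup>+y. h t x y * h t x z \<partial>\<sigma> \<partial>\<sigma> \<partial>\<omega> \<partial>lborel)"
    by (simp add: power2_eq_square nn_integral_multc nn_integral_cmult)
  \<comment> \<open>Three applications of Tonelli move the \<open>t\<close>-integral innermost,
    where it produces the factor that tames the singularity.\<close>
  also have "\<dots> = (\<integral>\<^sup>+x. \<integral>\<^sup>+t. \<integral>\<^sup>+z. \<integral>\<^sup>+y. h t x y * h t x z \<partial>\<sigma> \<partial>\<sigma> \<partial>lborel \<partial>\<omega>)"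
    by (rule lo.Fubini') measurable
  also have "\<dots> = (\<integral>\<^sup>+x. \<integral>\<^sup>+z. \<integral>\<^sup>+t. \<integral>\<^sup>+y. h t x y * h t x z \<partial>\<sigma> \<partial>lborel \<partial>\<sigma> \<partial>\<omega>)"
    by (intro nn_integral_cong ls.Fubini') measurable
  also have "\<dots> = (\<integral>\<^sup>+x. \<integral>\<^sup>+z. \<integral>\<^sup>+y. \<integral>\<^sup>+t. h t x y * h t x z \<partial>lborel \<partial>\<sigma> \<partial>\<sigma> \<partial>\<omega>)"
    by (intro nn_integral_cong ls.Fubini') measurable
  also have "\<dots> \<le> (\<integral>\<^sup>+x. \<integral>\<^sup>+z. \<integral>\<^sup>+y. (\<Sum>k. e k x z y) \<partial>\<sigma> \<partial>\<sigma> \<partial>\<omega>)"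
  proof (intro nn_integral_mono)
    fix x z y
    show "(\<integral>\<^sup>+t. h t x y * h t x z \<partial>lborel) \<le> (\<Sum>k. e k x z y)"
    proof (cases "x \<in> Q \<and> y \<in> Q \<and> z \<in> Q \<and> x < y \<and> x < z")
      case True
      have "(\<integral>\<^sup>+t. h t x y * h t x z \<partial>lborel) = (\<integral>\<^sup>+t. (if x < t \<and> t \<le> y \<and> t \<le> z
          then ennreal (c * (y - x) powr (\<alpha> - 1)) * ennreal (c * (z - x) powr (\<alpha> - 1)) else 0) \<partial>lborel)"
        using True by (intro nn_integral_cong) (auto simp: h_def)
      also have "\<dots> \<le> (\<Sum>k. w k * (if y - x \<le> R k \<and> z - x \<le> R k then 1 else 0))"
        unfolding w_def using True Ql[of y x] Ql[of z x]
        by (intro nn_integral_split_point_le[where l = l]) (auto simp: R_def)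
      also have "\<dots> = (\<Sum>k. e k x z y)" using True by (simp add: e_def)
      finally show ?thesis .
    next
      case False
      then have "(\<integral>\<^sup>+t. h t x y * h t x z \<partial>lborel) = (\<integral>\<^sup>+t. 0 \<partial>(lborel :: real measure))"
        by (intro nn_integral_cong) (auto simp: h_def)
      then show ?thesis by simp
    qed
  qed
  also have "\<dots> = (\<Sum>k. \<integral>\<^sup>+x. \<integral>\<^sup>+z. \<integral>\<^sup>+y. e k x z y \<partial>\<sigma> \<partial>\<sigma> \<partial>\<omega>)"
    by (simp add: nn_integral_suminf)
  \<comment> \<open>\<open>z\<close> moves outermost: it becomes the centre of the intervals, and
    its own integral over \<open>Q\<close> finally supplies the factor
    \<open>emeasure \<sigma> Q\<close>.\<close>
  also have "\<dots> = (\<Sum>k. \<integral>\<^sup>+z. \<integral>\<^sup>+x. \<integral>\<^sup>+y. e k x z y \<partial>\<sigma> \<partial>\<omega> \<partial>\<sigma>)"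
    by (intro suminf_cong so.Fubini') measurable
  also have "\<dots> \<le> (\<Sum>k. \<integral>\<^sup>+z. ennreal (18 * c\<^sup>2 * R k) * A2_const \<alpha> \<sigma> \<omega> * indicator Q z \<partial>\<sigma>)"
  proof (intro suminf_le summableI nn_integral_mono)
    fix k z
    \<comment> \<open>Where \<open>e k x z y\<close> is nonzero, \<open>y\<close> and
      \<open>z\<close> lie in \<open>{x<..x + R k}\<close>, so both \<open>x\<close> and
      \<open>y\<close> are within \<open>R k\<close> of \<open>z\<close>.\<close>
    define I where "I = {z - R k..z + R k}"
    have [measurable]: "I \<in> sets borel" by (simp add: I_def)
    have "(\<integral>\<^sup>+x. \<integral>\<^sup>+y. e k x z y \<partial>\<sigma> \<partial>\<omega>)
        \<le> (\<integral>\<^sup>+x. \<integral>\<^sup>+y. (w k * indicator Q z) * indicator I x * indicator I y \<partial>\<sigma> \<partial>\<omega>)"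
      by (intro nn_integral_mono) (auto simp: e_def I_def)
    also have "\<dots> = indicator Q z * (w k * (emeasure \<sigma> I * emeasure \<omega> I))"
      by (simp add: nn_integral_cmult nn_integral_multc mult_ac)
    also have "\<dots> \<le> indicator Q z * (w k * (ennreal (9 * R k powr (2 - 2 * \<alpha>)) * A2_const \<alpha> \<sigma> \<omega>))"
      unfolding I_def using \<alpha> Rp by (intro mult_left_mono A2_const_interval) auto
    also have "\<dots> = (w k * ennreal (9 * R k powr (2 - 2 * \<alpha>))) * A2_const \<alpha> \<sigma> \<omega> * indicator Q z"
      by (simp only: mult_ac)
    \<comment> \<open>The exponents \<open>2 * \<alpha> - 1\<close> and
      \<open>2 - 2 * \<alpha>\<close> add up to 1, so each scale contributes a multiple of
      \<open>R k\<close> for every \<alpha>; 18 is 2 times 9.\<close>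
    also have "w k * ennreal (9 * R k powr (2 - 2 * \<alpha>)) = ennreal (18 * c\<^sup>2 * R k)"
    proof -
      have "R k powr (2 * \<alpha> - 1) * R k powr (2 - 2 * \<alpha>) = R k"
        using Rp[of k] by (simp flip: powr_add)
      moreover have "2 * c\<^sup>2 * p * (9 * q) = 18 * c\<^sup>2 * (p * q)" for p q by simp
      ultimately have "2 * c\<^sup>2 * R k powr (2 * \<alpha> - 1) * (9 * R k powr (2 - 2 * \<alpha>)) = 18 * c\<^sup>2 * R k"
        by presburger
      moreover have "w k * ennreal (9 * R k powr (2 - 2 * \<alpha>))
          = ennreal (2 * c\<^sup>2 * R k powr (2 * \<alpha> - 1) * (9 * R k powr (2 - 2 * \<alpha>)))"
        unfolding w_def by (intro ennreal_mult[symmetric]) auto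
      ultimately show ?thesis by (simp only:)
    qed
    finally show "(\<integral>\<^sup>+x. \<integral>\<^sup>+y. e k x z y \<partial>\<sigma> \<partial>\<omega>)
        \<le> ennreal (18 * c\<^sup>2 * R k) * A2_const \<alpha> \<sigma> \<omega> * indicator Q z" .
  qed
  also have "\<dots> = (\<Sum>k. ennreal (18 * c\<^sup>2 * R k) * A2_const \<alpha> \<sigma> \<omega> * emeasure \<sigma> Q)"
    by (intro suminf_cong nn_integral_cmult_indicator) simp
  also have "\<dots> = (\<Sum>k. ennreal (18 * c\<^sup>2 * R k)) * (A2_const \<alpha> \<sigma> \<omega> * emeasure \<sigma> Q)"
    by (simp only: mult.assoc ennreal_suminf_multc)
  \<comment> \<open>The geometric series of ratio \<open>1 / 2\<close> doubles 18 to 36.\<close>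
  also have "(\<Sum>k. ennreal (18 * c\<^sup>2 * R k)) = ennreal (36 * c\<^sup>2 * l)"
  proof (rule suminf_ennreal_eq)
    have "(\<lambda>k. 18 * c\<^sup>2 * l * (1 / 2) ^ k) sums (18 * c\<^sup>2 * l * (1 / (1 - 1 / 2)))"
      by (intro sums_mult geometric_sums) auto
    then show "(\<lambda>k. 18 * c\<^sup>2 * R k) sums (36 * c\<^sup>2 * l)"
      by (simp add: R_def power_one_over mult.assoc)
    show "0 \<le> 18 * c\<^sup>2 * R k" for k using Rp[of k] by simp
  qed
  finally show ?thesis by (simp add: l_def mult.assoc)
qed

end

section \<open>Monomials as superpositions of indicators of tails\<close>

lemma le_two_power_diff_1: "real j \<le> 2 ^ (j - 1)"
proof (cases j)
  case (Suc k)
  have "Suc k \<le> 2 ^ k" by (simp add: Suc_leI)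
  then have "real (Suc k) \<le> real (2 ^ k)" by (rule of_nat_mono)
  then show ?thesis using Suc by simp
qed simp

text \<open>Fundamental theorem of calculus from the left endpoint, which lies half a side length
  from the centre, whence \<open>(- 1 / 2) ^ j\<close>. As a function of \<open>y\<close> in
  \<open>Q\<close> the indicator is that of a tail, so the monomial is a constant plus a weighted
  integral of tails.\<close>

lemma monomial_integral_representation:
  assumes Q: "Q \<in> cubes" and y: "y \<in> Q"
  shows "(LINT t|lborel. (real j / side Q * ((t - center Q) / side Q) ^ (j - 1)) * indicator {Inf Q..y} t)
    = monomial Q j y - (- 1 / 2) ^ j"
proof -
  have l: "side Q > 0" using cube_endpoints(1,5)[OF Q] by simp
  have "(Inf Q - center Q) / side Q = - 1 / 2"
    using l by (simp add: center_def cube_endpoints(5)[OF Q] field_simps)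
  then have "(- 1 / 2) ^ j = monomial Q j (Inf Q)" by (simp add: monomial_def)
  moreover have "(LINT t|lborel. (real j / side Q * ((t - center Q) / side Q) ^ (j - 1)) * indicator {Inf Q..y} t)
      = monomial Q j y - monomial Q j (Inf Q)"
  proof (rule integral_FTC_Icc_real)
    show "Inf Q \<le> y" using cube_endpoints(3)[OF Q] y by auto
    show "DERIV (monomial Q j) t :> real j / side Q * ((t - center Q) / side Q) ^ (j - 1)" for t
    proof -
      have "((\<lambda>t. (t - center Q) / side Q) has_field_derivative 1 / side Q) (at t)"
        using l by (auto intro!: derivative_eq_intros)
      from DERIV_power[OF this, of j] show ?thesis
        by (simp add: monomial_def[abs_def] mult_ac)
    qed
    show "isCont (\<lambda>t. real j / side Q * ((t - center Q) / side Q) ^ (j - 1)) t" for t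
      using l by (intro continuous_intros) auto
  qed
  ultimately show ?thesis by simp
qed

text \<open>The normalised variable is at most \<open>1 / 2\<close> in absolute value, and
  \<open>j * (1 / 2) ^ (j - 1) \<le> 1\<close>, so the bound does not grow with
  \<open>j\<close>.\<close>

lemma monomial_weight_le:
  assumes Q: "Q \<in> cubes" and t: "Inf Q \<le> t" "t \<le> Sup Q"
  shows "\<bar>real j / side Q * ((t - center Q) / side Q) ^ (j - 1)\<bar> \<le> 1 / side Q"
proof -
  have l: "side Q > 0" using cube_endpoints(1,5)[OF Q] by simp
  have "\<bar>t - center Q\<bar> \<le> side Q / 2"
    using t unfolding center_def cube_endpoints(5)[OF Q] by (auto simp: abs_le_iff field_simps)
  then have "\<bar>(t - center Q) / side Q\<bar> \<le> 1 / 2" using l by (simp add: field_simps)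
  then have "\<bar>(t - center Q) / side Q\<bar> ^ (j - 1) \<le> (1 / 2) ^ (j - 1)" by (intro power_mono) auto
  then have "real j * \<bar>(t - center Q) / side Q\<bar> ^ (j - 1) \<le> real j * (1 / 2) ^ (j - 1)"
    by (intro mult_left_mono) auto
  also have "\<dots> \<le> 1"
    using le_two_power_diff_1[of j] by (simp add: power_one_over divide_le_eq)
  finally have "real j * \<bar>(t - center Q) / side Q\<bar> ^ (j - 1) / side Q \<le> 1 / side Q"
    using l by (intro divide_right_mono) auto
  moreover have "\<bar>real j / side Q * ((t - center Q) / side Q) ^ (j - 1)\<bar>
      = real j * \<bar>(t - center Q) / side Q\<bar> ^ (j - 1) / side Q"
    unfolding abs_mult power_abs using l by simp
  ultimately show ?thesis by simp
qed

text \<open>Jensen's inequality for the uniform average over \<open>{a..b}\<close>: Cauchy-Schwarz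
  against the indicator, then Tonelli.\<close>

lemma nn_integral_average_power2_le:
  fixes g :: "real \<Rightarrow> 'b \<Rightarrow> ennreal"
  assumes "sigma_finite_measure M" and ab: "a < b"
    and g [measurable]: "case_prod g \<in> borel_measurable (lborel \<Otimes>\<^sub>M M)"
  shows "(\<integral>\<^sup>+x. (ennreal (1 / (b - a)) * (\<integral>\<^sup>+t\<in>{a..b}. g t x \<partial>lborel))\<^sup>2 \<partial>M)
    \<le> ennreal (1 / (b - a)) * (\<integral>\<^sup>+t\<in>{a..b}. (\<integral>\<^sup>+x. (g t x)\<^sup>2 \<partial>M) \<partial>lborel)"
proof -
  interpret M: sigma_finite_measure M by fact
  interpret P: pair_sigma_finite M lborel ..
  have [measurable]: "(\<lambda>(x, t). g t x) \<in> borel_measurable (M \<Otimes>\<^sub>M lborel)"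
    using measurable_pair_swap[OF g] by (simp add: case_prod_beta)
  have "(ennreal (1 / (b - a)) * (\<integral>\<^sup>+t\<in>{a..b}. g t x \<partial>lborel))\<^sup>2
      \<le> ennreal (1 / (b - a)) * (\<integral>\<^sup>+t\<in>{a..b}. (g t x)\<^sup>2 \<partial>lborel)" if "x \<in> space M" for x
  proof -
    have [measurable]: "(\<lambda>t. g t x) \<in> borel_measurable lborel" using that by measurable
    have "(\<integral>\<^sup>+t\<in>{a..b}. g t x \<partial>lborel)\<^sup>2
        = (\<integral>\<^sup>+t. indicator {a..b} t * (g t x * indicator {a..b} t) \<partial>lborel)\<^sup>2"
      by (intro arg_cong[of _ _ "\<lambda>z. z\<^sup>2"] nn_integral_cong) (auto simp: indicator_def)
    also have "\<dots> \<le> (\<integral>\<^sup>+t. (indicator {a..b} t)\<^sup>2 \<partial>lborel) * (\<integral>\<^sup>+t. (g t x * indicator {a..b} t)\<^sup>2 \<partial>lborel)"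
      by (rule Cauchy_Schwarz_nn_integral) auto
    also have "(\<integral>\<^sup>+t. (indicator {a..b} t)\<^sup>2 \<partial>lborel) = (\<integral>\<^sup>+t. indicator {a..b} t \<partial>lborel)"
      by (intro nn_integral_cong) (auto simp: indicator_def)
    also have "\<dots> = ennreal (b - a)" using ab by simp
    also have "(\<integral>\<^sup>+t. (g t x * indicator {a..b} t)\<^sup>2 \<partial>lborel) = (\<integral>\<^sup>+t\<in>{a..b}. (g t x)\<^sup>2 \<partial>lborel)"
      by (intro nn_integral_cong) (auto simp: indicator_def)
    finally have "(ennreal (1 / (b - a)))\<^sup>2 * (\<integral>\<^sup>+t\<in>{a..b}. g t x \<partial>lborel)\<^sup>2
        \<le> (ennreal (1 / (b - a)))\<^sup>2 * (ennreal (b - a) * (\<integral>\<^sup>+t\<in>{a..b}. (g t x)\<^sup>2 \<partial>lborel))"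
      by (rule mult_left_mono) simp
    also have "\<dots> = ((ennreal (1 / (b - a)))\<^sup>2 * ennreal (b - a)) * (\<integral>\<^sup>+t\<in>{a..b}. (g t x)\<^sup>2 \<partial>lborel)"
      by (simp only: mult_ac)
    also have "(ennreal (1 / (b - a)))\<^sup>2 * ennreal (b - a) = ennreal (1 / (b - a))"
      using ab by (simp add: power2_eq_square flip: ennreal_mult)
    finally show ?thesis by (simp add: power_mult_distrib)
  qed
  then have "(\<integral>\<^sup>+x. (ennreal (1 / (b - a)) * (\<integral>\<^sup>+t\<in>{a..b}. g t x \<partial>lborel))\<^sup>2 \<partial>M)
      \<le> (\<integral>\<^sup>+x. ennreal (1 / (b - a)) * (\<integral>\<^sup>+t\<in>{a..b}. (g t x)\<^sup>2 \<partial>lborel) \<partial>M)"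
    by (intro nn_integral_mono) auto
  also have "\<dots> = ennreal (1 / (b - a)) * (\<integral>\<^sup>+x. \<integral>\<^sup>+t. (g t x)\<^sup>2 * indicator {a..b} t \<partial>lborel \<partial>M)"
    by (rule nn_integral_cmult) measurable
  also have "(\<integral>\<^sup>+x. \<integral>\<^sup>+t. (g t x)\<^sup>2 * indicator {a..b} t \<partial>lborel \<partial>M)
      = (\<integral>\<^sup>+t. \<integral>\<^sup>+x. (g t x)\<^sup>2 * indicator {a..b} t \<partial>M \<partial>lborel)"
    by (rule P.Fubini'[symmetric]) measurable
  also have "\<dots> = (\<integral>\<^sup>+t\<in>{a..b}. (\<integral>\<^sup>+x. (g t x)\<^sup>2 \<partial>M) \<partial>lborel)"
    by (intro nn_integral_cong nn_integral_multc) measurable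
  finally show ?thesis .
qed

section \<open>From testing on indicators to testing on monomials\<close>

context two_weight_kernel
begin

text \<open>The integral representation of the monomial is inserted under the operator and the
  integrals in \<open>t\<close> and \<open>y\<close> are exchanged. The factor \<open>1 / 2\<close>
  bounds \<open>\<bar>(- 1 / 2) ^ j\<bar>\<close>, which is where \<open>j \<ge> 1\<close> enters,
  and \<open>1 / side Q\<close> bounds the weight.\<close>

lemma norm_monomial_op_le:
  assumes Q: "Q \<in> cubes" and j: "j \<ge> 1"
  shows "ennreal (norm (LINT y|\<sigma>. L x y * of_real (indicator Q y * monomial Q j y)))
    \<le> ennreal (1 / 2) * ennreal (norm (tail_op Q (Inf Q) x))
      + ennreal (1 / side Q) * (\<integral>\<^sup>+t\<in>{Inf Q..Sup Q}. ennreal (norm (tail_op Q t x)) \<partial>lborel)"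
proof -
  define w where "w t = real j / side Q * ((t - center Q) / side Q) ^ (j - 1)" for t
  have [measurable]: "w \<in> borel_measurable borel" unfolding w_def by measurable
  have w: "\<bar>w t\<bar> \<le> 1 / side Q" if "Inf Q \<le> t" "t \<le> Sup Q" for t
    unfolding w_def using monomial_weight_le[OF Q that] .
  have l: "side Q > 0" using cube_endpoints(1,5)[OF Q] by simp
  have Qm [measurable]: "Q \<in> sets borel" by (rule cube_endpoints(4)[OF Q])
  have Qs: "Inf Q \<le> y" "y \<le> Sup Q" if "y \<in> Q" for y using cube_endpoints(3)[OF Q] that by auto
  obtain B where B: "\<And>x y. norm (L x y) \<le> B" using L_bounded by blast
  then have "0 \<le> B" using norm_ge_zero order_trans by blast
  define f where "f t y = (if y \<in> Q \<and> Inf Q \<le> t \<and> t \<le> Sup Q \<and> t \<le> y then w t *\<^sub>R L x y else 0)" for t y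
  interpret P: pair_sigma_finite lborel \<sigma> ..
  have [measurable]: "case_prod f \<in> borel_measurable (lborel \<Otimes>\<^sub>M \<sigma>)"
    unfolding f_def by measurable
  \<comment> \<open>Fubini for the Bochner integral needs integrability on the product:
    \<open>f\<close> is bounded and supported in \<open>{Inf Q..Sup Q} \<times> Q\<close>, which has
    finite measure.\<close>
  have int: "integrable (lborel \<Otimes>\<^sub>M \<sigma>) (case_prod f)"
  proof (rule integrableI_bounded_set[where A = "{Inf Q..Sup Q} \<times> Q" and B = "1 / side Q * B"])
    show "emeasure (lborel \<Otimes>\<^sub>M \<sigma>) ({Inf Q..Sup Q} \<times> Q) < \<infinity>"
      using locally_finite_emeasure_bounded[OF \<sigma>, of Q] Q cube_endpoints(1)[OF Q]
      by (subst sigma.emeasure_pair_measure_Times) (auto simp: cubes_def ennreal_mult_less_top)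
    have "norm (f t y) \<le> 1 / side Q * B" for t y
      unfolding f_def using mult_mono[of "\<bar>w t\<bar>" "1 / side Q" "norm (L x y)" B] w[of t] B[of x y] \<open>0 \<le> B\<close> l
      by auto
    then show "AE z in lborel \<Otimes>\<^sub>M \<sigma>. z \<in> {Inf Q..Sup Q} \<times> Q \<longrightarrow> norm (case_prod f z) \<le> 1 / side Q * B"
      by (intro AE_I2) auto
  qed (auto simp: f_def intro!: AE_I2 split: if_splits)
  \<comment> \<open>The condition \<open>Inf Q \<le> y\<close> holds on all of \<open>Q\<close>; it
    is written out so that the constant term becomes \<open>tail_op Q (Inf Q)\<close>.\<close>
  have repr: "L x y * of_real (indicator Q y * monomial Q j y)
      = (- 1 / 2) ^ j *\<^sub>R (if y \<in> Q \<and> Inf Q \<le> y then L x y else 0) + (LINT t|lborel. f t y)" for y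
  proof (cases "y \<in> Q")
    case True
    have "integrable lborel (\<lambda>t. w t * indicator {Inf Q..y} t)"
    proof (rule integrableI_bounded_set[where A = "{Inf Q..y}" and B = "1 / side Q"])
      have "\<bar>w t\<bar> \<le> 1 / side Q" if "t \<in> {Inf Q..y}" for t
        using w[of t] that Qs(2)[OF True] by simp
      then show "AE t in lborel. t \<in> {Inf Q..y} \<longrightarrow> norm (w t * indicator {Inf Q..y} t) \<le> 1 / side Q"
        by (intro AE_I2) auto
    qed (use Qs[OF True] in auto)
    then have "(LINT t|lborel. (w t * indicator {Inf Q..y} t) *\<^sub>R L x y)
        = (monomial Q j y - (- 1 / 2) ^ j) *\<^sub>R L x y"
      using monomial_integral_representation[OF Q True, of j] by (simp add: w_def)
    moreover have "(LINT t|lborel. f t y) = (LINT t|lborel. (w t * indicator {Inf Q..y} t) *\<^sub>R L x y)"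
      using True Qs[OF True] by (intro Bochner_Integration.integral_cong) (auto simp: f_def indicator_def)
    ultimately have "(LINT t|lborel. f t y) = (monomial Q j y - (- 1 / 2) ^ j) *\<^sub>R L x y" by simp
    then show ?thesis using True Qs[OF True]
      by (simp add: scaleR_conv_of_real algebra_simps)
  qed (simp add: f_def)
  have "(LINT y|\<sigma>. L x y * of_real (indicator Q y * monomial Q j y))
      = (LINT y|\<sigma>. (- 1 / 2) ^ j *\<^sub>R (if y \<in> Q \<and> Inf Q \<le> y then L x y else 0))
        + (LINT y|\<sigma>. LINT t|lborel. f t y)"
    unfolding repr using integrable_tail[OF Q] P.integrable_snd[OF int]
    by (intro Bochner_Integration.integral_add) auto
  also have "(LINT y|\<sigma>. (- 1 / 2) ^ j *\<^sub>R (if y \<in> Q \<and> Inf Q \<le> y then L x y else 0))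
      = (- 1 / 2) ^ j *\<^sub>R tail_op Q (Inf Q) x"
    unfolding tail_op_def by (rule integral_scaleR_right)
  also have "(LINT y|\<sigma>. LINT t|lborel. f t y) = (LINT t|lborel. LINT y|\<sigma>. f t y)"
    by (rule P.Fubini_integral[OF int])
  finally have eq: "(LINT y|\<sigma>. L x y * of_real (indicator Q y * monomial Q j y))
      = (- 1 / 2) ^ j *\<^sub>R tail_op Q (Inf Q) x + (LINT t|lborel. LINT y|\<sigma>. f t y)" .
  have "norm ((- 1 / 2) ^ j *\<^sub>R tail_op Q (Inf Q) x) \<le> 1 / 2 * norm (tail_op Q (Inf Q) x)"
  proof -
    have "(1 / 2) ^ j \<le> (1 / 2 :: real) ^ 1" using j by (intro power_decreasing) auto
    then have "(1 / 2) ^ j * norm (tail_op Q (Inf Q) x) \<le> (1 / 2) ^ 1 * norm (tail_op Q (Inf Q) x)"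
      by (rule mult_right_mono) simp
    moreover have "norm ((- 1 / 2) ^ j *\<^sub>R tail_op Q (Inf Q) x) = (1 / 2) ^ j * norm (tail_op Q (Inf Q) x)"
      by (simp add: power_abs)
    ultimately show ?thesis by (simp only: power_one_right)
  qed
  then have "ennreal (norm ((- 1 / 2) ^ j *\<^sub>R tail_op Q (Inf Q) x))
      \<le> ennreal (1 / 2) * ennreal (norm (tail_op Q (Inf Q) x))"
    by (subst ennreal_mult[symmetric]) (auto intro: ennreal_leI)
  moreover have "ennreal (norm (LINT t|lborel. LINT y|\<sigma>. f t y))
      \<le> ennreal (1 / side Q) * (\<integral>\<^sup>+t\<in>{Inf Q..Sup Q}. ennreal (norm (tail_op Q t x)) \<partial>lborel)"
  proof -
    have "ennreal (norm (LINT t|lborel. LINT y|\<sigma>. f t y)) \<le> (\<integral>\<^sup>+t. ennreal (norm (LINT y|\<sigma>. f t y)) \<partial>lborel)"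
      by (rule integral_norm_bound_ennreal[OF P.integrable_fst[OF int]])
    also have "\<dots> \<le> (\<integral>\<^sup>+t. ennreal (1 / side Q) * (ennreal (norm (tail_op Q t x)) * indicator {Inf Q..Sup Q} t) \<partial>lborel)"
    proof (intro nn_integral_mono)
      fix t
      show "ennreal (norm (LINT y|\<sigma>. f t y))
          \<le> ennreal (1 / side Q) * (ennreal (norm (tail_op Q t x)) * indicator {Inf Q..Sup Q} t)"
      proof (cases "Inf Q \<le> t \<and> t \<le> Sup Q")
        case True
        have "(LINT y|\<sigma>. f t y) = (LINT y|\<sigma>. w t *\<^sub>R (if y \<in> Q \<and> t \<le> y then L x y else 0))"
          using True by (intro Bochner_Integration.integral_cong) (auto simp: f_def)
        also have "\<dots> = w t *\<^sub>R tail_op Q t x"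
          unfolding tail_op_def by (rule integral_scaleR_right)
        finally have "norm (LINT y|\<sigma>. f t y) \<le> 1 / side Q * norm (tail_op Q t x)"
          using w[of t] True by (simp add: mult_right_mono del: times_divide_eq_left)
        then have "ennreal (norm (LINT y|\<sigma>. f t y)) \<le> ennreal (1 / side Q) * ennreal (norm (tail_op Q t x))"
          using l by (subst ennreal_mult[symmetric]) (auto intro: ennreal_leI)
        then show ?thesis using True by simp
      next
        case False
        then have "f t y = 0" for y by (auto simp: f_def)
        then show ?thesis by simp
      qed
    qed
    also have "\<dots> = ennreal (1 / side Q) * (\<integral>\<^sup>+t\<in>{Inf Q..Sup Q}. ennreal (norm (tail_op Q t x)) \<partial>lborel)"
      by (rule nn_integral_cmult) measurable
    finally show ?thesis .
  qed
  moreover have "ennreal (norm (LINT y|\<sigma>. L x y * of_real (indicator Q y * monomial Q j y)))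
      \<le> ennreal (norm ((- 1 / 2) ^ j *\<^sub>R tail_op Q (Inf Q) x)) + ennreal (norm (LINT t|lborel. LINT y|\<sigma>. f t y))"
    unfolding eq ennreal_plus[symmetric, OF norm_ge_zero norm_ge_zero]
    by (intro ennreal_leI norm_triangle_ineq)
  ultimately show ?thesis by (meson add_mono order_trans)
qed

text \<open>For \<open>x\<close> in the tail \<open>Q \<inter> {t..}\<close> this is testing on the
  indicator of that same tail, a cube of no larger \<sigma>-measure than \<open>Q\<close>.\<close>

lemma tail_op_testing:
  assumes T: "\<And>I. I \<in> cubes \<Longrightarrow>
      (\<integral>\<^sup>+x\<in>I. (ennreal (norm (LINT y|\<sigma>. L x y * of_real (indicator I y))))\<^sup>2 \<partial>\<omega>) \<le> \<tau>\<^sup>2 * emeasure \<sigma> I"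
    and Q: "Q \<in> cubes" and t: "t < Sup Q"
  shows "(\<integral>\<^sup>+x. (if x \<in> Q \<and> t \<le> x then (ennreal (norm (tail_op Q t x)))\<^sup>2 else 0) \<partial>\<omega>)
    \<le> \<tau>\<^sup>2 * emeasure \<sigma> Q"
proof -
  let ?I = "Q \<inter> {t..}"
  have "(LINT y|\<sigma>. L x y * of_real (indicator ?I y)) = tail_op Q t x" for x
    unfolding tail_op_def by (intro Bochner_Integration.integral_cong) (auto simp: indicator_def)
  then have "(\<integral>\<^sup>+x. (if x \<in> Q \<and> t \<le> x then (ennreal (norm (tail_op Q t x)))\<^sup>2 else 0) \<partial>\<omega>)
      = (\<integral>\<^sup>+x\<in>?I. (ennreal (norm (LINT y|\<sigma>. L x y * of_real (indicator ?I y))))\<^sup>2 \<partial>\<omega>)"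
    by (intro nn_integral_cong) (auto simp: indicator_def)
  also have "\<dots> \<le> \<tau>\<^sup>2 * emeasure \<sigma> ?I" by (rule T[OF cubes_Int_atLeast[OF Q t]])
  also have "\<dots> \<le> \<tau>\<^sup>2 * emeasure \<sigma> Q"
    using cube_endpoints(4)[OF Q] by (intro mult_left_mono emeasure_mono) auto
  finally show ?thesis .
qed

text \<open>Three pieces are added by Minkowski: \<open>F0\<close> from the constant term,
  \<open>F1\<close> from the average over cuts \<open>t \<le> x\<close>, and \<open>F2\<close> from
  cuts \<open>t > x\<close>. The first two cost \<tau> each by testing, the last costs the
  Muckenhoupt term.\<close>

lemma monomial_testing:
  assumes T: "\<And>I. I \<in> cubes \<Longrightarrow>
      (\<integral>\<^sup>+x\<in>I. (ennreal (norm (LINT y|\<sigma>. L x y * of_real (indicator I y))))\<^sup>2 \<partial>\<omega>) \<le> \<tau>\<^sup>2 * emeasure \<sigma> I"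
    and Q: "Q \<in> cubes" and j: "j \<ge> 1"
  shows "(\<integral>\<^sup>+x\<in>Q. (ennreal (norm (LINT y|\<sigma>. L x y * of_real (indicator Q y * monomial Q j y))))\<^sup>2 \<partial>\<omega>)
    \<le> (2 * \<tau> + ennreal (6 * c) * enn_sqrt (A2_const \<alpha> \<sigma> \<omega>))\<^sup>2 * emeasure \<sigma> Q"
proof -
  define l where "l = Sup Q - Inf Q"
  have l: "l > 0" "side Q = l" using cube_endpoints(1,5)[OF Q] by (auto simp: l_def)
  have Qm [measurable]: "Q \<in> sets borel" by (rule cube_endpoints(4)[OF Q])
  define s where "s = enn_sqrt (emeasure \<sigma> Q)"
  define A where "A = enn_sqrt (A2_const \<alpha> \<sigma> \<omega>)"
  have s: "s\<^sup>2 = emeasure \<sigma> Q" and A: "A\<^sup>2 = A2_const \<alpha> \<sigma> \<omega>" by (auto simp: s_def A_def enn_sqrt_power2)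
  define g where "g t x = ennreal (norm (tail_op Q t x))" for t x
  have [measurable]: "(\<lambda>z. g (f z) (f' z)) \<in> borel_measurable N"
    if [measurable]: "f \<in> borel_measurable N" "f' \<in> borel_measurable N"
    for f f' :: "'z \<Rightarrow> real" and N unfolding g_def by measurable
  define g1 g2 where "g1 t x = (if x \<in> Q \<and> t \<le> x then g t x else 0)"
    and "g2 t x = (if x \<in> Q \<and> x < t then g t x else 0)" for t x
  have [measurable]: "(\<lambda>z. g1 (f z) (f' z)) \<in> borel_measurable N" "(\<lambda>z. g2 (f z) (f' z)) \<in> borel_measurable N"
    if [measurable]: "f \<in> borel_measurable N" "f' \<in> borel_measurable N"
    for f f' :: "'z \<Rightarrow> real" and N unfolding g1_def g2_def by measurable
  define F0 where "F0 x = ennreal (1 / 2) * (g (Inf Q) x * indicator Q x)" for x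
  define F1 F2 where "F1 x = ennreal (1 / l) * (\<integral>\<^sup>+t\<in>{Inf Q..Sup Q}. g1 t x \<partial>lborel)"
    and "F2 x = ennreal (1 / l) * (\<integral>\<^sup>+t\<in>{Inf Q..Sup Q}. g2 t x \<partial>lborel)" for x
  have [measurable]: "F0 \<in> borel_measurable \<omega>" "F1 \<in> borel_measurable \<omega>" "F2 \<in> borel_measurable \<omega>"
    unfolding F0_def F1_def F2_def by measurable

  have tst: "(\<integral>\<^sup>+x. (g1 t x)\<^sup>2 \<partial>\<omega>) \<le> (\<tau> * s)\<^sup>2" if "t < Sup Q" for t
  proof -
    have "(\<integral>\<^sup>+x. (g1 t x)\<^sup>2 \<partial>\<omega>)
        = (\<integral>\<^sup>+x. (if x \<in> Q \<and> t \<le> x then (ennreal (norm (tail_op Q t x)))\<^sup>2 else 0) \<partial>\<omega>)"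
      by (intro nn_integral_cong) (auto simp: g1_def g_def)
    also have "\<dots> \<le> \<tau>\<^sup>2 * emeasure \<sigma> Q" by (rule tail_op_testing[OF T Q that])
    finally show ?thesis by (simp add: power_mult_distrib s)
  qed
  have F0: "(\<integral>\<^sup>+x. (F0 x)\<^sup>2 \<partial>\<omega>) \<le> (\<tau> * s)\<^sup>2"
  proof -
    \<comment> \<open>The factor \<open>1 / 2\<close> is given away here: the total
      \<open>1 + 1 = 2\<close> is still absorbed by the factorial in the end.\<close>
    have "F0 x \<le> g1 (Inf Q) x" for x
    proof -
      have "ennreal (1 / 2) * z \<le> z" for z
        using mult_right_mono[of "ennreal (1 / 2)" 1 z] unfolding ennreal_le_1 by simp
      then show ?thesis using cube_endpoints(3)[OF Q] by (auto simp: F0_def g1_def indicator_def)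
    qed
    then have "(\<integral>\<^sup>+x. (F0 x)\<^sup>2 \<partial>\<omega>) \<le> (\<integral>\<^sup>+x. (g1 (Inf Q) x)\<^sup>2 \<partial>\<omega>)"
      by (intro nn_integral_mono power_mono) auto
    also have "\<dots> \<le> (\<tau> * s)\<^sup>2" by (rule tst) (rule cube_endpoints(1)[OF Q])
    finally show ?thesis .
  qed
  have F1: "(\<integral>\<^sup>+x. (F1 x)\<^sup>2 \<partial>\<omega>) \<le> (\<tau> * s)\<^sup>2"
  proof -
    have "(\<integral>\<^sup>+x. (F1 x)\<^sup>2 \<partial>\<omega>) \<le> ennreal (1 / l) * (\<integral>\<^sup>+t\<in>{Inf Q..Sup Q}. (\<integral>\<^sup>+x. (g1 t x)\<^sup>2 \<partial>\<omega>) \<partial>lborel)"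
      unfolding F1_def l_def
      by (intro nn_integral_average_power2_le omega.sigma_finite_measure_axioms cube_endpoints(1)[OF Q])
        measurable
    also have "(\<integral>\<^sup>+t\<in>{Inf Q..Sup Q}. (\<integral>\<^sup>+x. (g1 t x)\<^sup>2 \<partial>\<omega>) \<partial>lborel)
        \<le> (\<integral>\<^sup>+t. (\<tau> * s)\<^sup>2 * indicator {Inf Q..Sup Q} t \<partial>lborel)"
    proof (intro nn_integral_mono_AE)
      \<comment> \<open>At \<open>t = Sup Q\<close> the tail has at most one point and is not a
        cube; this single cut is a null set for the average.\<close>
      show "AE t in lborel. (\<integral>\<^sup>+x. (g1 t x)\<^sup>2 \<partial>\<omega>) * indicator {Inf Q..Sup Q} t
          \<le> (\<tau> * s)\<^sup>2 * indicator {Inf Q..Sup Q} t"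
        using AE_lborel_singleton[of "Sup Q"] by eventually_elim (auto simp: indicator_def intro: tst)
    qed
    also have "\<dots> = (\<tau> * s)\<^sup>2 * ennreal l"
      using l by (subst nn_integral_cmult_indicator) (auto simp: l_def)
    finally have "(\<integral>\<^sup>+x. (F1 x)\<^sup>2 \<partial>\<omega>) \<le> ennreal (1 / l) * ((\<tau> * s)\<^sup>2 * ennreal l)"
      by (simp add: mult_left_mono)
    also have "\<dots> = (ennreal (1 / l) * ennreal l) * (\<tau> * s)\<^sup>2" by (simp only: mult_ac)
    also have "ennreal (1 / l) * ennreal l = 1" using l by (simp flip: ennreal_mult)
    finally show ?thesis by simp
  qed
  have F2: "(\<integral>\<^sup>+x. (F2 x)\<^sup>2 \<partial>\<omega>) \<le> (ennreal (6 * c) * A * s)\<^sup>2"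
  proof -
    have "(\<integral>\<^sup>+x. (F2 x)\<^sup>2 \<partial>\<omega>) \<le> ennreal (1 / l) * (\<integral>\<^sup>+t\<in>{Inf Q..Sup Q}. (\<integral>\<^sup>+x. (g2 t x)\<^sup>2 \<partial>\<omega>) \<partial>lborel)"
      unfolding F2_def l_def
      by (intro nn_integral_average_power2_le omega.sigma_finite_measure_axioms cube_endpoints(1)[OF Q])
        measurable
    also have "(\<integral>\<^sup>+t\<in>{Inf Q..Sup Q}. (\<integral>\<^sup>+x. (g2 t x)\<^sup>2 \<partial>\<omega>) \<partial>lborel)
        \<le> (\<integral>\<^sup>+t. \<integral>\<^sup>+x. (if x \<in> Q \<and> x < t then (ennreal (norm (tail_op Q t x)))\<^sup>2 else 0) \<partial>\<omega> \<partial>lborel)"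
    proof (intro nn_integral_mono)
      fix t
      have "(\<integral>\<^sup>+x. (g2 t x)\<^sup>2 \<partial>\<omega>)
          = (\<integral>\<^sup>+x. (if x \<in> Q \<and> x < t then (ennreal (norm (tail_op Q t x)))\<^sup>2 else 0) \<partial>\<omega>)"
        by (intro nn_integral_cong) (auto simp: g2_def g_def)
      then show "(\<integral>\<^sup>+x. (g2 t x)\<^sup>2 \<partial>\<omega>) * indicator {Inf Q..Sup Q} t
          \<le> (\<integral>\<^sup>+x. (if x \<in> Q \<and> x < t then (ennreal (norm (tail_op Q t x)))\<^sup>2 else 0) \<partial>\<omega>)"
        by (simp add: indicator_def)
    qed
    also have "\<dots> \<le> ennreal (36 * c\<^sup>2 * l) * A\<^sup>2 * s\<^sup>2"
      using nn_integral_tail_op_off_diagonal[OF Q] by (simp add: l A s)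
    finally have "(\<integral>\<^sup>+x. (F2 x)\<^sup>2 \<partial>\<omega>) \<le> (ennreal (1 / l) * ennreal (36 * c\<^sup>2 * l)) * A\<^sup>2 * s\<^sup>2"
      by (simp add: mult_left_mono mult.assoc)
    \<comment> \<open>The average cancels the length, and 6 is the root of 36.\<close>
    also have "ennreal (1 / l) * ennreal (36 * c\<^sup>2 * l) = (ennreal (6 * c))\<^sup>2"
      using l c by (simp add: ennreal_power power_mult_distrib flip: ennreal_mult)
    finally show ?thesis by (simp add: power_mult_distrib)
  qed
  have "(\<integral>\<^sup>+x\<in>Q. (ennreal (norm (LINT y|\<sigma>. L x y * of_real (indicator Q y * monomial Q j y))))\<^sup>2 \<partial>\<omega>)
      \<le> (\<integral>\<^sup>+x. ((F0 x + F1 x) + F2 x)\<^sup>2 \<partial>\<omega>)"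
  proof (intro nn_integral_mono)
    fix x
    have "ennreal (norm (LINT y|\<sigma>. L x y * of_real (indicator Q y * monomial Q j y))) \<le> F0 x + F1 x + F2 x"
      if x: "x \<in> Q"
    proof -
      have "(\<integral>\<^sup>+t\<in>{Inf Q..Sup Q}. g t x \<partial>lborel)
          = (\<integral>\<^sup>+t. g1 t x * indicator {Inf Q..Sup Q} t + g2 t x * indicator {Inf Q..Sup Q} t \<partial>lborel)"
        using x by (intro nn_integral_cong) (auto simp: g1_def g2_def indicator_def)
      also have "\<dots> = (\<integral>\<^sup>+t\<in>{Inf Q..Sup Q}. g1 t x \<partial>lborel) + (\<integral>\<^sup>+t\<in>{Inf Q..Sup Q}. g2 t x \<partial>lborel)"
        by (rule nn_integral_add) measurable
      finally show ?thesis
        using norm_monomial_op_le[OF Q j, of x] x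
        by (simp add: F0_def F1_def F2_def g_def l distrib_left add.assoc)
    qed
    then show "(ennreal (norm (LINT y|\<sigma>. L x y * of_real (indicator Q y * monomial Q j y))))\<^sup>2 * indicator Q x
        \<le> ((F0 x + F1 x) + F2 x)\<^sup>2"
      by (auto simp: indicator_def intro: power_mono)
  qed
  also have "\<dots> \<le> ((\<tau> * s + \<tau> * s) + ennreal (6 * c) * A * s)\<^sup>2"
    by (intro nn_integral_Minkowski2 F0 F1 F2) measurable
  also have "\<dots> = ((2 * \<tau> + ennreal (6 * c) * A) * s)\<^sup>2"
    by (simp only: distrib_right mult_2)
  also have "\<dots> = (2 * \<tau> + ennreal (6 * c) * A)\<^sup>2 * emeasure \<sigma> Q"
    by (simp only: power_mult_distrib s)
  finally show ?thesis by (simp add: A_def)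
qed

end

section \<open>Passage to the suprema, with the final constants\<close>

theorem lemma2:
  fixes \<alpha> C_CZ :: real and \<kappa> :: nat
  assumes "0 \<le> \<alpha>" and "\<alpha> < 1" and "\<kappa> \<ge> 1"
  shows "\<exists>C::real. C > 0 \<and>
    (\<forall>(\<sigma> :: real measure) (\<omega> :: real measure)
      (K :: real \<Rightarrow> real \<Rightarrow> 'a::{real_normed_field,banach,second_countable_topology}) \<eta>.
       locally_finite_borel \<sigma> \<longrightarrow> locally_finite_borel \<omega> \<longrightarrow>
       fractional_CZ_operator \<alpha> C_CZ K \<eta> \<longrightarrow>
       bounded_L2_op K \<eta> \<sigma> \<omega> \<longrightarrow>
       testing_const \<kappa> K \<eta> \<sigma> \<omega>
         \<le> ennreal (fact \<kappa>) * testing_const 1 K \<eta> \<sigma> \<omega> + ennreal C * enn_sqrt (A2_const \<alpha> \<sigma> \<omega>))"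
\<comment> \<open>The 6 comes from \<open>monomial_testing\<close> with
  \<open>c = \<bar>C_CZ\<bar>\<close>; the absolute value and the summand 1 make the witness
  positive for every \<open>C_CZ\<close>.\<close>
proof (intro exI[of _ "6 * \<bar>C_CZ\<bar> + 1"] conjI allI impI)
  fix \<sigma> \<omega> :: "real measure" and K :: "real \<Rightarrow> real \<Rightarrow> 'a" and \<eta>
  assume \<sigma>: "locally_finite_borel \<sigma>" and \<omega>: "locally_finite_borel \<omega>"
    and op: "fractional_CZ_operator \<alpha> C_CZ K \<eta>"
  define \<tau> where "\<tau> = testing_const 1 K \<eta> \<sigma> \<omega>"
  define A where "A = enn_sqrt (A2_const \<alpha> \<sigma> \<omega>)"
  let ?B = "ennreal (fact \<kappa>) * \<tau> + ennreal (6 * \<bar>C_CZ\<bar> + 1) * A"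
  have finite: "emeasure \<sigma> Q < \<infinity>" if "Q \<in> cubes" for Q
    using locally_finite_emeasure_bounded[OF \<sigma>] that by (simp add: cubes_def)
  have "testing_const \<kappa> K \<eta> \<sigma> \<omega> \<le> ?B"
    unfolding testing_const_def
  proof (rule enn_sqrt_leI, rule SUP_least, unfold split_paired_all prod.case, intro SUP_least, clarify)
    fix \<epsilon> R Q j
    assume tr: "(\<epsilon>, R) \<in> truncations" and Q: "Q \<in> cubes" "0 < emeasure \<sigma> Q" and j: "j < \<kappa>"
    interpret two_weight_kernel \<sigma> \<omega> \<alpha> "\<bar>C_CZ\<bar>" "truncated_kernel \<eta> K \<epsilon> R"
      using truncated_kernel_properties[OF \<open>\<alpha> < 1\<close> op tr] assms \<sigma> \<omega>
      by unfold_locales auto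
    let ?L = "truncated_kernel \<eta> K \<epsilon> R"
    have T: "(\<integral>\<^sup>+x\<in>I. (ennreal (norm (LINT y|\<sigma>. ?L x y * of_real (indicator I y))))\<^sup>2 \<partial>\<omega>)
        \<le> \<tau>\<^sup>2 * emeasure \<sigma> I" (is "?X \<le> _") if I: "I \<in> cubes" for I
    \<comment> \<open>Cubes of \<sigma>-measure zero are excluded from the supremum, but a tail of
      \<open>Q\<close> can be such a cube; the operator applied to its indicator is then 0.\<close>
    proof (cases "emeasure \<sigma> I = 0")
      case True
      have Im: "I \<in> sets \<sigma>" using cube_endpoints(4)[OF I] by simp
      have "AE y in \<sigma>. y \<notin> I" by (rule AE_not_in) (use True Im in \<open>auto simp: null_sets_def\<close>)
      then have "AE y in \<sigma>. ?L x y * of_real (indicator I y) = 0" for x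
        by eventually_elim auto
      then have "(LINT y|\<sigma>. ?L x y * of_real (indicator I y)) = 0" for x
        by (rule integral_eq_zero_AE)
      then show ?thesis by simp
    next
      case False
      have "1 / emeasure \<sigma> I * ?X \<le> \<tau>\<^sup>2"
        unfolding \<tau>_def testing_const_def enn_sqrt_power2
      proof (rule SUP_upper2[OF tr], unfold prod.case, rule SUP_upper2[of I], goal_cases)
        case 1
        then show ?case using I False by (simp add: zero_less_iff_neq_zero)
      next
        case 2
        show ?case by (rule SUP_upper2[of 0]) (simp_all add: T_op_def monomial_def)
      qed
      then have "emeasure \<sigma> I * (1 / emeasure \<sigma> I * ?X) \<le> emeasure \<sigma> I * \<tau>\<^sup>2" by (rule mult_left_mono) simp
      moreover have "emeasure \<sigma> I * (1 / emeasure \<sigma> I * ?X) = (emeasure \<sigma> I / emeasure \<sigma> I) * ?X"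
        by (simp add: divide_ennreal_def mult.assoc)
      \<comment> \<open>In \<open>ennreal\<close> the quotient \<open>a / a\<close> is 1 only for
        positive finite \<open>a\<close>; finiteness holds because cubes are bounded and \<sigma> is
        locally finite.\<close>
      moreover have "emeasure \<sigma> I / emeasure \<sigma> I = 1"
        using False finite[OF I] by (intro ennreal_divide_self) auto
      ultimately show ?thesis by (simp add: mult.commute)
    qed
    have "(\<integral>\<^sup>+x\<in>Q. (ennreal (norm (T_op K \<eta> \<epsilon> R \<sigma> (\<lambda>y. of_real (indicator Q y * monomial Q j y)) x)))\<^sup>2 \<partial>\<omega>)
        \<le> ?B\<^sup>2 * emeasure \<sigma> Q" (is "?Y \<le> _")
    \<comment> \<open>For \<open>j = 0\<close> the monomial is 1 and the claim is testing on the
      indicator; \<open>0 < j\<close> and \<open>j < \<kappa>\<close> force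
      \<open>\<kappa> \<ge> 2\<close>, which gives \<open>2 \<le> fact \<kappa>\<close>.\<close>
    proof (cases "j = 0")
      case True
      have "1 * \<tau> \<le> ennreal (fact \<kappa>) * \<tau>"
        using fact_ge_1[of \<kappa>, where 'a = real] by (intro mult_right_mono) auto
      then have "\<tau> \<le> ?B" by (simp add: add_increasing2)
      then have "\<tau>\<^sup>2 * emeasure \<sigma> Q \<le> ?B\<^sup>2 * emeasure \<sigma> Q" by (intro mult_right_mono power_mono) auto
      then show ?thesis using T[OF Q(1)] True by (simp add: T_op_def monomial_def)
    next
      case False
      then have "fact 2 \<le> (fact \<kappa> :: real)" using j by (intro fact_mono) auto
      then have two: "2 * \<tau> \<le> ennreal (fact \<kappa>) * \<tau>"
        using ennreal_leI[of 2 "fact \<kappa>"] by (intro mult_right_mono) auto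
      have le: "2 * \<tau> + ennreal (6 * \<bar>C_CZ\<bar>) * A \<le> ?B"
        by (intro add_mono two mult_right_mono ennreal_leI) auto
      have "?Y \<le> (2 * \<tau> + ennreal (6 * \<bar>C_CZ\<bar>) * A)\<^sup>2 * emeasure \<sigma> Q"
        unfolding T_op_def A_def using monomial_testing[OF T Q(1), of j] False by simp
      also have "\<dots> \<le> ?B\<^sup>2 * emeasure \<sigma> Q" using le by (intro mult_right_mono power_mono) auto
      finally show ?thesis .
    qed
    then have "1 / emeasure \<sigma> Q * ?Y \<le> 1 / emeasure \<sigma> Q * (?B\<^sup>2 * emeasure \<sigma> Q)" by (rule mult_left_mono) simp
    also have "\<dots> = (emeasure \<sigma> Q / emeasure \<sigma> Q) * ?B\<^sup>2"
      unfolding divide_ennreal_def by (simp only: mult_ac mult_1_left mult_1_right)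
    also have "emeasure \<sigma> Q / emeasure \<sigma> Q = 1"
      using Q(2) finite[OF Q(1)] by (intro ennreal_divide_self) auto
    also have "1 * ?B\<^sup>2 = ?B\<^sup>2" by simp
    finally show "1 / emeasure \<sigma> Q * ?Y \<le> ?B\<^sup>2" .
  qed
  then show "testing_const \<kappa> K \<eta> \<sigma> \<omega>
      \<le> ennreal (fact \<kappa>) * testing_const 1 K \<eta> \<sigma> \<omega> + ennreal (6 * \<bar>C_CZ\<bar> + 1) * enn_sqrt (A2_const \<alpha> \<sigma> \<omega>)"
    by (simp add: \<tau>_def A_def)
qed simp

end
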